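(* For generic $x=(x_{11}:x_{12}:x_{21}:x_{22})\in\mathbb{P}^3$ (i.e. for all $x$ in some nonempty Zariski-open subset of $\mathbb{P}^3$), the $k$-algebra $S_x$ has dimension $18$ over $k$ and is isomorphic to $k^{\oplus 9}\oplus M_3(k)$, the direct sum of $9$ copies of $k$ and the matrix algebra of order $3$ over $k$.
   Context: $k$ is an algebraically closed field of characteristic zero; all algebras are unital and associative. For $x=(x_{11}:x_{12}:x_{21}:x_{22})\in\mathbb{P}^3=\mathbb{P}^3(k)$, $S_x$ is the unital associative $k$-algebra generated by $p_1,p_2,q_1,q_2$ subject to the relations $p_ip_j=\delta_{ij}p_i$, $q_iq_j=\delta_{ij}q_i$ ($i,j=1,2$) and $\sum_{i,j=1}^2 x_{ij}[p_i,q_j]=0$, where $[a,b]=ab-ba$. Equivalently, $S_x$ is the quotient of the free product $k^{\oplus 3}*k^{\oplus 3}$ (of unital algebras) by the last relation, where $p_1,p_2,p_3=1-p_1-p_2$ and $q_1,q_2,q_3=1-q_1-q_2$ are the primitive orthogonal idempotents of the two factors. *)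

theory Defs
  imports
    "HOL-Algebra.QuotRing"
    "HOL-Algebra.Chinese_Remainder"
    "HOL-Library.Poly_Mapping"
    "HOL-Analysis.Finite_Cartesian_Product"
    "Jordan_Normal_Form.VS_Connect"
begin

no_notation Matrix.vec_index (infixl "$" 100)

section \<open>Associative algebras over a field\<close>

text \<open>
  The ground field is a type \<open>'k\<close>; as a ring record it is \<^const>\<open>class_ring\<close>. A \<open>'k\<close>-algebra is
  represented by a record of type \<open>('k, 'a) module\<close>, which carries a ring structure together with a
  scalar multiplication. (The locale \<^locale>\<open>algebra\<close> of the library is for commutative algebras only.)
\<close>

definition algebra_iso :: "('k, 'a) module \<Rightarrow> ('k, 'b) module \<Rightarrow> ('a \<Rightarrow> 'b) set"
  where "algebra_iso A B =
    {h \<in> ring_iso A B. \<forall>c. \<forall>a\<in>carrier A. h (c \<odot>\<^bsub>A\<^esub> a) = c \<odot>\<^bsub>B\<^esub> h a}"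

definition algebra_direct_sum :: "('k, 'a) module \<Rightarrow> ('k, 'b) module \<Rightarrow> ('k, 'a \<times> 'b) module"
  where "algebra_direct_sum A B =
    ring.extend (RDirProd A B) (module.fields (\<lambda>c (a, b). (c \<odot>\<^bsub>A\<^esub> a, c \<odot>\<^bsub>B\<^esub> b)))"

text \<open>The direct sum of \<open>CARD('n)\<close> copies of the field; multiplication in \<open>'k ^ 'n\<close> is componentwise.\<close>

definition power_algebra :: "('k::field, 'k ^ 'n) module"
  where "power_algebra =
    \<lparr>carrier = UNIV, mult = (*), one = 1, zero = 0, add = (+), smult = (*s)\<rparr>"

definition matrix_algebra :: "('k::field, 'k ^ 'n ^ 'n) module"
  where "matrix_algebra =
    \<lparr>carrier = UNIV, mult = (**), one = Finite_Cartesian_Product.mat 1, zero = 0, add = (+),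
     smult = (\<lambda>c A. \<chi> i j. c * A $ i $ j)\<rparr>"

text \<open>The scalar multiplication on cosets follows the pattern of \<^const>\<open>rcoset_mult\<close>.\<close>

definition quotient_algebra :: "('k, 'a) module \<Rightarrow> 'a set \<Rightarrow> ('k, 'a set) module"
  where "quotient_algebra A I =
    ring.extend (A Quot I) (module.fields (\<lambda>c X. \<Union>a\<in>X. I +>\<^bsub>A\<^esub> (c \<odot>\<^bsub>A\<^esub> a)))"


section \<open>Free algebras, generators and relations\<close>

text \<open>
  The free monoid on \<open>'g\<close> is written additively, so that the convolution product of
  \<^theory>\<open>HOL-Library.Poly_Mapping\<close> turns \<open>'g free_monoid \<Rightarrow>\<^sub>0 'k\<close> into its monoid algebra, which is the
  free associative algebra.
\<close>

datatype 'g free_monoid = Word (letters: "'g list")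

instantiation free_monoid :: (type) monoid_add
begin

definition "0 = Word []"
definition "u + v = Word (letters u @ letters v)"

instance
  by standard (auto simp: zero_free_monoid_def plus_free_monoid_def)

end

type_synonym ('k, 'g) free_alg = "'g free_monoid \<Rightarrow>\<^sub>0 'k"

definition gen :: "'g \<Rightarrow> ('k::field, 'g) free_alg"
  where "gen g = Poly_Mapping.single (Word [g]) 1"

definition scalar :: "'k \<Rightarrow> ('k::field, 'g) free_alg"
  where "scalar c = Poly_Mapping.single 0 c"

definition free_algebra :: "('k::field, ('k, 'g) free_alg) module"
  where "free_algebra =
    \<lparr>carrier = UNIV, mult = (*), one = 1, zero = 0, add = (+), smult = (\<lambda>c f. scalar c * f)\<rparr>"

text \<open>\<^const>\<open>genideal\<close> is the two-sided ideal generated by a set.\<close>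

definition presented_algebra :: "('k::field, 'g) free_alg set \<Rightarrow> ('k, ('k, 'g) free_alg set) module"
  where "presented_algebra R = quotient_algebra free_algebra (Idl\<^bsub>free_algebra\<^esub> R)"

lemma scalar_simps:
  "scalar 1 = 1" "scalar (a + b) = scalar a + scalar b" "scalar (a * b) = scalar a * scalar b"
  by (simp_all add: scalar_def single_add mult_single)

lemma ring_free_algebra: "ring (free_algebra :: ('k::field, ('k, 'g) free_alg) module)"
  by (rule ringI, rule abelian_groupI)
     (auto simp: free_algebra_def algebra_simps intro!: monoidI intro: exI[of _ "- x" for x])

lemma carrier_free_algebra [simp]: "carrier free_algebra = UNIV"
  by (simp add: free_algebra_def)

lemma ring_extend_ring:
  fixes R (structure)
  assumes "ring R"
  shows "ring (ring.extend R X)"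
proof -
  interpret ring R by (rule assms)
  note [simp] = ring.defs(3)
  show ?thesis
  proof (rule ringI)
    show "abelian_group (ring.extend R X)"
      by (rule abelian_groupI) (auto simp: a_ac intro: l_neg a_inv_closed)
    show "Group.monoid (ring.extend R X)"
      by (rule Group.monoidI) (auto simp: m_assoc)
  qed (auto simp: l_distr r_distr)
qed

lemma ring_presented_algebra: "ring (presented_algebra R)"
proof -
  interpret ring free_algebra by (rule ring_free_algebra)
  interpret ideal "Idl\<^bsub>free_algebra\<^esub> R" free_algebra by (rule genideal_ideal) simp
  from quotient_is_ring show ?thesis
    unfolding presented_algebra_def quotient_algebra_def by (rule ring_extend_ring)
qed

lemma vectorspace_presented_algebra: "vectorspace class_ring (presented_algebra R)"
proof -
  interpret F: ring free_algebra by (rule ring_free_algebra)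
  define I where "I = Idl\<^bsub>free_algebra\<^esub> R"
  interpret I: ideal I free_algebra unfolding I_def by (rule F.genideal_ideal) simp
  interpret P: ring "presented_algebra R" by (rule ring_presented_algebra)
  have carrier: "carrier (presented_algebra R) = {I +>\<^bsub>free_algebra\<^esub> f |f. True}"
    by (auto simp: presented_algebra_def quotient_algebra_def ring.defs FactRing_def
        A_RCOSETS_def' I_def)
  have add: "(I +>\<^bsub>free_algebra\<^esub> f) \<oplus>\<^bsub>presented_algebra R\<^esub> (I +>\<^bsub>free_algebra\<^esub> g)
      = I +>\<^bsub>free_algebra\<^esub> (f + g)" for f g
    using I.a_rcos_sum[of f g]
    by (simp add: presented_algebra_def quotient_algebra_def ring.defs FactRing_def I_def)
       (simp add: free_algebra_def)
  have eq: "I +>\<^bsub>free_algebra\<^esub> (scalar c * f) = I +>\<^bsub>free_algebra\<^esub> (scalar c * g)"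
    if "f \<in> I +>\<^bsub>free_algebra\<^esub> g" for c f g
  proof -
    from that obtain h where h: "h \<in> I" "f = h + g"
      by (auto simp: a_r_coset_def' free_algebra_def)
    have "scalar c * h \<in> I"
      using I.I_l_closed[of h "scalar c"] h by (simp add: free_algebra_def)
    then have "scalar c * f \<in> I +>\<^bsub>free_algebra\<^esub> (scalar c * g)"
      using h by (auto simp: a_r_coset_def' free_algebra_def distrib_left)
    then show ?thesis
      using I.a_repr_independence'[of "scalar c * f" "scalar c * g"] by simp
  qed
  have smult: "c \<odot>\<^bsub>presented_algebra R\<^esub> (I +>\<^bsub>free_algebra\<^esub> f)
      = I +>\<^bsub>free_algebra\<^esub> (scalar c * f)" for c f
  proof -
    have "c \<odot>\<^bsub>presented_algebra R\<^esub> (I +>\<^bsub>free_algebra\<^esub> f)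
      = (\<Union>g\<in>I +>\<^bsub>free_algebra\<^esub> f. I +>\<^bsub>free_algebra\<^esub> (scalar c * g))"
      by (simp add: presented_algebra_def quotient_algebra_def ring.defs module.defs I_def)
         (simp add: free_algebra_def)
    also have "\<dots> = (\<Union>g\<in>I +>\<^bsub>free_algebra\<^esub> f. I +>\<^bsub>free_algebra\<^esub> (scalar c * f))"
      using eq by blast
    also have "\<dots> = I +>\<^bsub>free_algebra\<^esub> (scalar c * f)"
      using I.a_rcos_self[of f] by auto
    finally show ?thesis .
  qed
  have "module class_ring (presented_algebra R)"
    by (rule moduleI)
       (auto simp: carrier add smult scalar_simps distrib_left distrib_right mult.assoc
         intro: class_cring.cring_axioms P.abelian_group_axioms)
  then show ?thesis
    by (intro vectorspace.intro class_field)
qed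


section \<open>Projective space and its Zariski topology\<close>

text \<open>
  Points of projective space of dimension \<open>CARD('n) - 1\<close> are the classes of nonzero vectors of
  \<open>'k ^ 'n\<close> up to nonzero scalars. Polynomials in variables indexed by \<open>'n\<close> map exponent vectors to
  coefficients.
\<close>

definition proj_point :: "'k::field ^ 'n \<Rightarrow> ('k ^ 'n) set"
  where "proj_point x = {c *s x |c. c \<noteq> 0}"

definition proj_space :: "('k::field ^ 'n) set set"
  where "proj_space = {proj_point x |x. x \<noteq> 0}"

type_synonym ('k, 'n) mpolynomial = "('n \<Rightarrow>\<^sub>0 nat) \<Rightarrow>\<^sub>0 'k"

definition eval_mpoly :: "('k::field, 'n::finite) mpolynomial \<Rightarrow> 'k ^ 'n \<Rightarrow> 'k"
  where "eval_mpoly f x =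
    (\<Sum>m\<in>Poly_Mapping.keys f. Poly_Mapping.lookup f m * (\<Prod>v\<in>UNIV. x $ v ^ Poly_Mapping.lookup m v))"

definition homogeneous :: "nat \<Rightarrow> ('k::field, 'n::finite) mpolynomial \<Rightarrow> bool"
  where "homogeneous d f \<longleftrightarrow>
    (\<forall>m\<in>Poly_Mapping.keys f. (\<Sum>v\<in>UNIV. Poly_Mapping.lookup m v) = d)"

definition zariski_closed :: "('k::field ^ 'n) set set \<Rightarrow> bool"
  where "zariski_closed Z \<longleftrightarrow>
    (\<exists>F :: ('k, 'n) mpolynomial set. (\<forall>f\<in>F. \<exists>d. homogeneous d f) \<and>
       Z = {proj_point x |x. x \<noteq> 0 \<and> (\<forall>f\<in>F. eval_mpoly f x = 0)})"

definition zariski_open :: "('k::field ^ 'n) set set \<Rightarrow> bool"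
  where "zariski_open U \<longleftrightarrow> U \<subseteq> proj_space \<and> zariski_closed (proj_space - U)"


section \<open>The algebras \<open>S\<^sub>x\<close>\<close>

text \<open>
  The index set is the two-element type \<open>2\<close> of \<^theory>\<open>HOL-Library.Numeral_Type\<close>, whose elements are
  \<open>1\<close> and \<open>2\<close> (where \<open>2 = 0\<close>).
\<close>

datatype S_gen = P "2" | Q "2"

definition S_relations :: "'k::field ^ (2 \<times> 2) \<Rightarrow> ('k, S_gen) free_alg set"
  where "S_relations x =
    {gen (P i) * gen (P j) - (if i = j then gen (P i) else 0) |i j. True} \<union>
    {gen (Q i) * gen (Q j) - (if i = j then gen (Q i) else 0) |i j. True} \<union>
    {\<Sum>i\<in>UNIV. \<Sum>j\<in>UNIV.
       scalar (x $ (i, j)) * (gen (P i) * gen (Q j) - gen (Q j) * gen (P i))}"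

definition S_algebra :: "'k::field ^ (2 \<times> 2) \<Rightarrow> ('k, ('k, S_gen) free_alg set) module"
  where "S_algebra x = presented_algebra (S_relations x)"

end

theory Submission
  imports Defs "HOL-Analysis.Cartesian_Space"
begin

text \<open>
  Put \<open>t = q\<^sub>1\<close>, \<open>y = q\<^sub>2\<close> and \<open>x\<^sub>3\<^sub>j = 0\<close>. Multiplying the commutator relation by \<open>p\<^sub>a\<close> and
  \<open>p\<^sub>b\<close> shows that it is equivalent to \<open>p\<^sub>a t p\<^sub>b = s\<^sub>c p\<^sub>a y p\<^sub>b\<close> for \<open>{a, b, c} = {1, 2, 3}\<close>, with
  scalars \<open>s\<^sub>c\<close> that are rational in \<open>x\<close>. The Peirce components of \<open>y\<^sup>2 = y\<close>, \<open>t\<^sup>2 = t\<close>, \<open>t y = y t = 0\<close> are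
  then linear equations, and eliminating gives \<open>p\<^sub>a y p\<^sub>b y p\<^sub>c = n\<^sub>b p\<^sub>a y p\<^sub>c\<close> for \<open>a \<noteq> c\<close> and all \<open>b\<close>, where
  \<open>n\<^sub>b = s\<^sub>b (s\<^sub>b + 1) / \<Prod>\<^sub>c (s\<^sub>b - s\<^sub>c)\<close>. Hence the \<open>p\<^sub>a y p\<^sub>b\<close> (\<open>a \<noteq> b\<close>) and the \<open>p\<^sub>a y p\<^sub>b y p\<^sub>a\<close> are multiples of
  nine matrix units, and together with the nine elements \<open>p\<^sub>a\<close>, \<open>p\<^sub>a t p\<^sub>a\<close>, \<open>p\<^sub>a y p\<^sub>a\<close> they span the algebra.

  Conversely, \<open>p\<^sub>a \<mapsto> E\<^sub>a\<^sub>a\<close>, \<open>y \<mapsto> (n\<^sub>b)\<^sub>a\<^sub>b\<close>, \<open>t \<mapsto> (s\<^sub>1 s\<^sub>2 s\<^sub>3 n\<^sub>b / (s\<^sub>a s\<^sub>b))\<^sub>a\<^sub>b\<close> is a representation by Lagrange's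
  identities \<open>\<Sum> n\<^sub>a = 1\<close>, \<open>\<Sum> n\<^sub>a / s\<^sub>a = 0\<close>, \<open>\<Sum> n\<^sub>a / s\<^sub>a\<^sup>2 = 1 / (s\<^sub>1 s\<^sub>2 s\<^sub>3)\<close>. Together with the nine
  characters \<open>p\<^sub>a, q\<^sub>b \<mapsto> 1\<close> it maps the eighteen spanning elements onto a basis of \<open>k\<^sup>9 \<oplus> M\<^sub>3(k)\<close>.
\<close>

section \<open>Congruence modulo an ideal of an algebra\<close>

text \<open>Computing with representatives modulo \<open>I\<close> keeps the type-class arithmetic
  of the ambient algebra, in place of the record operations on cosets.\<close>

locale algebra_congruence = vector_space scale
  for scale :: "'k::field \<Rightarrow> 'a::ring_1 \<Rightarrow> 'a" (infixr "*\<^sub>S" 75) +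
  fixes I :: "'a set"
  assumes scale_mult_left [simp]: "(c *\<^sub>S a) * b = c *\<^sub>S (a * b)"
    and scale_mult_right [simp]: "a * (c *\<^sub>S b) = c *\<^sub>S (a * b)"
    and subspace_I: "subspace I"
    and mult_left_I: "a \<in> I \<Longrightarrow> b * a \<in> I"
    and mult_right_I: "a \<in> I \<Longrightarrow> a * b \<in> I"
begin

definition cong :: "'a \<Rightarrow> 'a \<Rightarrow> bool"  (infix "\<approx>" 50)
  where "a \<approx> b \<longleftrightarrow> a - b \<in> I"

lemma cong_refl [simp, intro]: "a \<approx> a"
  using subspace_0[OF subspace_I] by (simp add: cong_def)

lemma cong_sym: "a \<approx> b \<Longrightarrow> b \<approx> a"
  using subspace_neg[OF subspace_I, of "a - b"] by (simp add: cong_def)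

lemma cong_trans [trans]: "a \<approx> b \<Longrightarrow> b \<approx> c \<Longrightarrow> a \<approx> c"
  using subspace_add[OF subspace_I, of "a - b" "b - c"] by (simp add: cong_def)

lemma cong_add: "a \<approx> b \<Longrightarrow> c \<approx> d \<Longrightarrow> a + c \<approx> b + d"
  using subspace_add[OF subspace_I, of "a - b" "c - d"] by (simp add: cong_def algebra_simps)

lemma cong_scale: "a \<approx> b \<Longrightarrow> c *\<^sub>S a \<approx> c *\<^sub>S b"
  using subspace_scale[OF subspace_I, of "a - b" c] by (simp add: cong_def scale_right_diff_distrib)

lemma cong_minus: "a \<approx> b \<Longrightarrow> - a \<approx> - b"
  using cong_scale[of a b "-1"] by simp

lemma cong_diff: "a \<approx> b \<Longrightarrow> c \<approx> d \<Longrightarrow> a - c \<approx> b - d"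
  using cong_add[OF _ cong_minus, of a b c d] by simp

lemma cong_replace2:
  "a + b \<approx> d \<Longrightarrow> a \<approx> a' \<Longrightarrow> b \<approx> b' \<Longrightarrow> d \<approx> d' \<Longrightarrow> a' + b' \<approx> d'"
  by (meson cong_add cong_sym cong_trans)

lemma cong_replace:
  "a + b + c \<approx> d \<Longrightarrow> a \<approx> a' \<Longrightarrow> b \<approx> b' \<Longrightarrow> c \<approx> c' \<Longrightarrow> d \<approx> d' \<Longrightarrow> a' + b' + c' \<approx> d'"
  by (meson cong_add cong_sym cong_trans)

lemma cong_left: "a \<approx> b \<Longrightarrow> c * a \<approx> c * b"
  using mult_left_I[of "a - b" c] by (simp add: cong_def right_diff_distrib)

lemma cong_right: "a \<approx> b \<Longrightarrow> a * c \<approx> b * c"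
  using mult_right_I[of "a - b" c] by (simp add: cong_def left_diff_distrib)

lemma cong_context: "a \<approx> b \<Longrightarrow> c * a * d \<approx> c * b * d"
  by (intro cong_left cong_right)

lemma cong_divide: "c \<noteq> 0 \<Longrightarrow> c *\<^sub>S a \<approx> d *\<^sub>S b \<Longrightarrow> a \<approx> (d / c) *\<^sub>S b"
  using cong_scale[of "c *\<^sub>S a" "d *\<^sub>S b" "inverse c"] by (simp add: divide_inverse mult.commute)

text \<open>Adding \<open>c * c\<close> times \<open>e1\<close> to \<open>e4\<close> and subtracting
  \<open>c\<close> times \<open>e2\<close> and \<open>e3\<close> cancels \<open>A\<close>,
  \<open>B\<close>, \<open>C\<close> and \<open>D\<close>. In the application \<open>A\<close>,
  \<open>B\<close>, \<open>E\<close> are words in \<open>y\<close> alone, while \<open>C\<close> and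
  \<open>D\<close> retain a diagonal \<open>t\<close>.\<close>

lemma eliminate:
  assumes e1: "A + B + E \<approx> Y" and e2: "C + c *\<^sub>S B + b *\<^sub>S E \<approx> 0"
    and e3: "c *\<^sub>S A + D + a *\<^sub>S E \<approx> 0"
    and e4: "c *\<^sub>S C + c *\<^sub>S D + (a * b) *\<^sub>S E \<approx> c *\<^sub>S Y"
  shows "((c - a) * (c - b)) *\<^sub>S E \<approx> (c * (c + 1)) *\<^sub>S Y"
proof -
  have "(c * c) *\<^sub>S (A + B + E) + (c *\<^sub>S C + c *\<^sub>S D + (a * b) *\<^sub>S E)
      - c *\<^sub>S (C + c *\<^sub>S B + b *\<^sub>S E) - c *\<^sub>S (c *\<^sub>S A + D + a *\<^sub>S E)
    \<approx> (c * c) *\<^sub>S Y + c *\<^sub>S Y - c *\<^sub>S 0 - c *\<^sub>S 0"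
    by (intro cong_diff cong_add cong_scale e1 e2 e3 e4)
  moreover have "(c * c) *\<^sub>S (A + B + E) + (c *\<^sub>S C + c *\<^sub>S D + (a * b) *\<^sub>S E)
      - c *\<^sub>S (C + c *\<^sub>S B + b *\<^sub>S E) - c *\<^sub>S (c *\<^sub>S A + D + a *\<^sub>S E)
     = ((c - a) * (c - b)) *\<^sub>S E"
    by (simp add: scale_right_distrib)
      (simp add: left_diff_distrib right_diff_distrib scale_left_diff_distrib mult.commute)
  ultimately show ?thesis
    by (simp add: distrib_left scale_left_distrib)
qed

text \<open>Spanning arguments do not depend on coefficients, so these are hidden and
  proportionality can be chained.\<close>

definition multiple :: "'a \<Rightarrow> 'a \<Rightarrow> bool"
  where "multiple v a \<longleftrightarrow> (\<exists>c. a \<approx> c *\<^sub>S v)"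

lemma multiple_I: "a \<approx> c *\<^sub>S v \<Longrightarrow> multiple v a"
  by (auto simp: multiple_def)

lemma multiple_refl [simp]: "multiple v v"
  by (rule multiple_I[of _ 1]) simp

lemma multiple_minus: "multiple v a \<Longrightarrow> multiple v (- a)"
  using cong_minus by (fastforce simp: multiple_def simp flip: scale_minus_left)

lemma multiple_diff: "multiple v a \<Longrightarrow> multiple v b \<Longrightarrow> multiple v (a - b)"
  using cong_diff by (fastforce simp: multiple_def simp flip: scale_left_diff_distrib)

lemma multiple_trans: "multiple v a \<Longrightarrow> multiple a b \<Longrightarrow> multiple v b"
  unfolding multiple_def by (metis cong_scale cong_trans scale_scale)

lemma multiple_cong: "b \<approx> a \<Longrightarrow> multiple v a \<Longrightarrow> multiple v b"
  unfolding multiple_def by (metis cong_trans)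

lemma multiple_left: "multiple v a \<Longrightarrow> multiple (b * v) (b * a)"
  using cong_left by (fastforce simp: multiple_def)

lemma multiple_right: "multiple v a \<Longrightarrow> multiple (v * b) (a * b)"
  using cong_right by (fastforce simp: multiple_def)

lemma multiple_in_subspace:
  "multiple v a \<Longrightarrow> subspace V \<Longrightarrow> I \<subseteq> V \<Longrightarrow> v \<in> V \<Longrightarrow> a \<in> V"
  unfolding multiple_def cong_def
  by (metis diff_add_cancel subsetD subspace_add subspace_scale)

end

section \<open>Three indices and Lagrange's identities\<close>

lemma exhaust_distinct_3:
  fixes a b c d :: 3
  assumes "distinct [a, b, c]"
  shows "d = a \<or> d = b \<or> d = c"
  using assms exhaust_3[of a] exhaust_3[of b] exhaust_3[of c] exhaust_3[of d] by auto

lemma sum_distinct_3: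
  fixes a b c :: 3
  assumes "distinct [a, b, c]"
  shows "sum f UNIV = f a + f b + (f c :: 'a::ab_group_add)"
proof -
  have U: "(UNIV :: 3 set) = {a, b, c}" using exhaust_distinct_3[OF assms] by auto
  show ?thesis unfolding U using assms by (simp add: add.assoc)
qed

lemma ex_distinct_3:
  fixes a b :: 3
  assumes "a \<noteq> b"
  obtains c where "distinct [a, b, c]"
proof -
  have "card (UNIV - {a, b}) \<noteq> 0" using assms by (simp add: card_Diff_subset)
  then obtain c where "c \<in> UNIV - {a, b}" by (metis all_not_in_conv card.empty)
  then show ?thesis using assms by (intro that[of c]) auto
qed

text \<open>The three sums are the second divided differences at \<open>x\<close>, \<open>y\<close>,
  \<open>z\<close> of the functions X(X + 1), X + 1 and 1 + 1/X.\<close>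

lemma lagrange_identities:
  fixes x y z :: "'k::field"
  assumes "x \<noteq> y" "x \<noteq> z" "y \<noteq> z" "x \<noteq> 0" "y \<noteq> 0" "z \<noteq> 0"
    and n: "l = x * (x + 1) / ((x - y) * (x - z))" "m = y * (y + 1) / ((y - x) * (y - z))"
      "n = z * (z + 1) / ((z - x) * (z - y))"
  shows "l + m + n = 1" "l / x + m / y + n / z = 0"
    "l / x^2 + m / y^2 + n / z^2 = 1 / (x * y * z)"
proof -
  \<comment> \<open>A Vandermonde determinant up to sign. Over this denominator (times
    \<open>x * y * z\<close> in the third case) each identity becomes one between
    polynomials.\<close>
  define D where "D = (x - y) * (x - z) * (y - z)"
  have D: "D \<noteq> 0" using assms by (simp add: D_def)
  have n': "l = x * (x + 1) * (y - z) / D" "m = - (y * (y + 1) * (x - z)) / D"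
    "n = z * (z + 1) * (x - y) / D"
    unfolding n D_def using assms by (simp_all add: divide_simps) (simp_all add: algebra_simps)
  have "x * (x + 1) * (y - z) + - (y * (y + 1) * (x - z)) + z * (z + 1) * (x - y) = D"
    by (simp add: algebra_simps D_def)
  then show "l + m + n = 1"
    unfolding n' add_divide_distrib[symmetric] using D by simp
  have e: "l / x = (x + 1) * (y - z) / D" "m / y = - ((y + 1) * (x - z)) / D"
    "n / z = (z + 1) * (x - y) / D"
    unfolding n' using assms by simp_all
  show "l / x + m / y + n / z = 0"
    unfolding e add_divide_distrib[symmetric] by (simp add: algebra_simps)
  have f: "l / x^2 = (x + 1) * (y - z) * (y * z) / (D * (x * y * z))"
    "m / y^2 = - ((y + 1) * (x - z)) * (x * z) / (D * (x * y * z))"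
    "n / z^2 = (z + 1) * (x - y) * (x * y) / (D * (x * y * z))"
    unfolding power2_eq_square divide_divide_eq_left[symmetric] e using assms by simp_all
  have "(x + 1) * (y - z) * (y * z) + - ((y + 1) * (x - z)) * (x * z) + (z + 1) * (x - y) * (x * y) = D"
    by (simp add: algebra_simps D_def)
  then show "l / x^2 + m / y^2 + n / z^2 = 1 / (x * y * z)"
    unfolding f add_divide_distrib[symmetric] using D by simp
qed

text \<open>Distinctness makes the denominators of the coefficients \<open>n\<close> nonzero; the
  other two conditions make \<open>n\<close> itself nonzero, so that it may be divided by.\<close>

locale S_parameters =
  fixes s :: "3 \<Rightarrow> 'k::field_char_0"
  assumes s_inj: "a \<noteq> b \<Longrightarrow> s a \<noteq> s b"
    and s_nonzero: "s a \<noteq> 0"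
    and s_plus_1: "s a + 1 \<noteq> 0"
begin

definition n :: "3 \<Rightarrow> 'k"
  where "n a = s a * (s a + 1) / (\<Prod>b\<in>UNIV - {a}. s a - s b)"

lemma n_eq:
  assumes "distinct [a, b, c]"
  shows "n a = s a * (s a + 1) / ((s a - s b) * (s a - s c))"
proof -
  have "UNIV - {a} = {b, c}" using assms exhaust_distinct_3[OF assms] by auto
  with assms show ?thesis by (simp add: n_def)
qed

lemma n_nonzero: "n a \<noteq> 0"
  using s_inj s_nonzero s_plus_1 by (auto simp: n_def)

lemma
  assumes "distinct [a, b, c]"
  shows n_sum: "n a + n b + n c = 1"
    and n_s_sum: "n a / s a + n b / s b + n c / s c = 0"
    and n_ss_sum: "n a / (s a)^2 + n b / (s b)^2 + n c / (s c)^2 = 1 / (s a * s b * s c)"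
proof -
  have "s a \<noteq> s b" "s a \<noteq> s c" "s b \<noteq> s c"
    using assms s_inj by auto
  moreover have "n a = s a * (s a + 1) / ((s a - s b) * (s a - s c))"
    "n b = s b * (s b + 1) / ((s b - s a) * (s b - s c))"
    "n c = s c * (s c + 1) / ((s c - s a) * (s c - s b))"
    using assms by (auto intro!: n_eq)
  ultimately show "n a + n b + n c = 1" "n a / s a + n b / s b + n c / s c = 0"
    "n a / (s a)^2 + n b / (s b)^2 + n c / (s c)^2 = 1 / (s a * s b * s c)"
    using s_nonzero by (intro lagrange_identities; assumption?; blast)+
qed

end

section \<open>Linear relations between Peirce components\<close>

locale S_congruence = algebra_congruence scale I + S_parameters s
  for scale :: "'k::field_char_0 \<Rightarrow> 'a::ring_1 \<Rightarrow> 'a" (infixr "*\<^sub>S" 75)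
    and I :: "'a set" and s :: "3 \<Rightarrow> 'k" +
  fixes p :: "3 \<Rightarrow> 'a" and t y :: 'a
  assumes p_mult: "p a * p b \<approx> (if a = b then p a else 0)"
    and p_sum: "(\<Sum>a\<in>UNIV. p a) = 1"
    and yy: "y * y \<approx> y" and tt: "t * t \<approx> t" and ty: "t * y \<approx> 0" and yt: "y * t \<approx> 0"
    and off_diagonal: "distinct [a, b, c] \<Longrightarrow> p a * t * p b \<approx> s c *\<^sub>S (p a * y * p b)"
begin

text \<open>Inserts \<open>1 = p a + p b + p c\<close> between \<open>u\<close> and
  \<open>v\<close>; the result is exact because \<open>p_sum\<close> is an equation and not a
  congruence.\<close>

lemma peirce:
  assumes "distinct [a, b, c]"
  shows "p d * (u * v) * p e = p d * u * p a * v * p e + p d * u * p b * v * p e + p d * u * p c * v * p e"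
proof -
  have "p d * (u * v) * p e = p d * u * (p a + p b + p c) * v * p e"
    using p_sum sum_distinct_3[OF assms, of p] by (simp add: mult.assoc)
  then show ?thesis by (simp add: algebra_simps)
qed

lemma off_diagonal_context:
  "distinct [a, b, c] \<Longrightarrow> u * p a * t * p b * v \<approx> s c *\<^sub>S (u * p a * y * p b * v)"
  using cong_context[OF off_diagonal, of a b c u v] by (simp add: mult.assoc)

text \<open>Once every off-diagonal \<open>t\<close> is replaced by a multiple of \<open>y\<close>,
  the (a, b) components of \<open>yy\<close>, \<open>ty\<close>, \<open>yt\<close>,
  \<open>tt\<close> become the linear equations \<open>e1\<close> to \<open>e4\<close> in the five
  words \<open>?A\<close> to \<open>?E\<close>, and \<open>eliminate\<close> solves them for
  \<open>?E\<close>.\<close>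

lemma
  assumes "distinct [a, b, c]"
  shows y_third: "p a * y * p c * y * p b \<approx> n c *\<^sub>S (p a * y * p b)" (is "?E \<approx> n c *\<^sub>S ?Y")
    and y_diagonal: "p a * y * p a * y * p b + p a * y * p b * y * p b \<approx> (1 - n c) *\<^sub>S (p a * y * p b)"
      (is "?A + ?B \<approx> _")
proof -
  let ?C = "p a * t * p a * y * p b" and ?D = "p a * y * p b * t * p b"
  have d: "distinct [a, c, b]" "distinct [c, b, a]" "distinct [a, b, c]" using assms by auto
  have e1: "?A + ?B + ?E \<approx> ?Y"
    using cong_context[OF yy, of "p a" "p b"] peirce[OF assms, of a y y b] by simp
  have "?C + p a * t * p b * y * p b + p a * t * p c * y * p b \<approx> 0"
    using cong_context[OF ty, of "p a" "p b"] peirce[OF assms, of a t y b] by simp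
  moreover have "p a * t * p b * y * p b \<approx> s c *\<^sub>S ?B"
    using off_diagonal_context[OF d(3), of 1 "y * p b"] by (simp add: mult.assoc)
  moreover have "p a * t * p c * y * p b \<approx> s b *\<^sub>S ?E"
    using off_diagonal_context[OF d(1), of 1 "y * p b"] by (simp add: mult.assoc)
  ultimately have e2: "?C + s c *\<^sub>S ?B + s b *\<^sub>S ?E \<approx> 0"
    by (blast intro: cong_replace cong_refl)
  have "p a * y * p a * t * p b + ?D + p a * y * p c * t * p b \<approx> 0"
    using cong_context[OF yt, of "p a" "p b"] peirce[OF assms, of a y t b] by simp
  moreover have "p a * y * p a * t * p b \<approx> s c *\<^sub>S ?A"
    using off_diagonal_context[OF d(3), of "p a * y" 1] by (simp add: mult.assoc)
  moreover have "p a * y * p c * t * p b \<approx> s a *\<^sub>S ?E"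
    using off_diagonal_context[OF d(2), of "p a * y" 1] by (simp add: mult.assoc)
  ultimately have e3: "s c *\<^sub>S ?A + ?D + s a *\<^sub>S ?E \<approx> 0"
    by (blast intro: cong_replace cong_refl)
  have "p a * t * p a * t * p b + p a * t * p b * t * p b + p a * t * p c * t * p b \<approx> p a * t * p b"
    using cong_context[OF tt, of "p a" "p b"] peirce[OF assms, of a t t b] by simp
  moreover have "p a * t * p a * t * p b \<approx> s c *\<^sub>S ?C"
    using off_diagonal_context[OF d(3), of "p a * t" 1] by (simp add: mult.assoc)
  moreover have "p a * t * p b * t * p b \<approx> s c *\<^sub>S ?D"
    using off_diagonal_context[OF d(3), of 1 "t * p b"] by (simp add: mult.assoc)
  \<comment> \<open>Both letters are off-diagonal: \<open>p c * t * p b\<close> contributes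
    \<open>s a\<close> and \<open>p a * t * p c\<close> contributes \<open>s b\<close>.\<close>
  moreover have "p a * t * p c * t * p b \<approx> (s a * s b) *\<^sub>S ?E"
    using cong_left[OF off_diagonal[OF d(2)], of "p a * t"]
      cong_scale[OF cong_right[OF off_diagonal[OF d(1)], of "y * p b"], of "s a"]
    by (simp add: mult.assoc cong_trans)
  moreover have "p a * t * p b \<approx> s c *\<^sub>S ?Y"
    by (rule off_diagonal[OF d(3)])
  ultimately have e4: "s c *\<^sub>S ?C + s c *\<^sub>S ?D + (s a * s b) *\<^sub>S ?E \<approx> s c *\<^sub>S ?Y"
    by (rule cong_replace)
  have "?E \<approx> (s c * (s c + 1) / ((s c - s a) * (s c - s b))) *\<^sub>S ?Y"
    using s_inj d by (intro cong_divide eliminate[OF e1 e2 e3 e4]) auto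
  then show E: "?E \<approx> n c *\<^sub>S ?Y"
    using n_eq[of c a b] d by auto
  show "?A + ?B \<approx> (1 - n c) *\<^sub>S ?Y"
    using cong_diff[OF e1 E] by (simp add: algebra_simps)
qed

text \<open>Taking \<open>e2\<close> minus \<open>e3\<close> plus \<open>d\<close> times
  \<open>e1\<close> cancels \<open>W\<close> and \<open>C\<close> and leaves \<open>2 * d\<close>
  times \<open>A\<close>; the division by 2 uses the characteristic.\<close>

lemma eliminate_middle:
  fixes a c d :: 'k
  assumes e1: "A + C \<approx> (1 - d) *\<^sub>S Y" and e2: "d *\<^sub>S A + W \<approx> ((1 - c) * d) *\<^sub>S Y"
    and e3: "W + d *\<^sub>S C \<approx> ((1 - a) * d) *\<^sub>S Y"
    and "a = 1 - c - d" "d \<noteq> 0"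
  shows "A \<approx> a *\<^sub>S Y"
proof -
  have "(d *\<^sub>S A + W) - (W + d *\<^sub>S C) + d *\<^sub>S (A + C)
    \<approx> ((1 - c) * d) *\<^sub>S Y - ((1 - a) * d) *\<^sub>S Y + d *\<^sub>S (1 - d) *\<^sub>S Y"
    by (intro cong_diff cong_add cong_scale e1 e2 e3)
  moreover have "(d *\<^sub>S A + W) - (W + d *\<^sub>S C) + d *\<^sub>S (A + C) = (2 * d) *\<^sub>S A"
    by (simp add: scale_right_distrib flip: scale_left_distrib)
  moreover have "((1 - c) * d) *\<^sub>S Y - ((1 - a) * d) *\<^sub>S Y + d *\<^sub>S (1 - d) *\<^sub>S Y = (2 * d * a) *\<^sub>S Y"
    unfolding scale_scale scale_left_diff_distrib[symmetric] scale_left_distrib[symmetric] \<open>a = _\<close>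
    by (rule arg_cong[of _ _ "\<lambda>c. c *\<^sub>S Y"]) (simp add: algebra_simps)
  ultimately have "A \<approx> (2 * d * a / (2 * d)) *\<^sub>S Y"
    using \<open>d \<noteq> 0\<close> by (intro cong_divide) auto
  then show ?thesis using \<open>d \<noteq> 0\<close> by simp
qed

lemma y_middle:
  assumes "a \<noteq> c"
  shows "p a * y * p b * y * p c \<approx> n b *\<^sub>S (p a * y * p c)"
proof -
  obtain d where d: "distinct [a, c, d]" using ex_distinct_3[OF assms] .
  let ?Y = "p a * y * p c" and ?A = "p a * y * p a * y * p c" and ?C = "p a * y * p c * y * p c"
  let ?W = "p a * y * p d * y * p d * y * p c"
  have d': "distinct [a, d, c]" "distinct [d, c, a]" "distinct [c, d, a]" using d by auto
  have n: "n a = 1 - n c - n d" using n_sum[OF d] by (simp add: algebra_simps)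
  have D: "p a * y * p d * y * p c \<approx> n d *\<^sub>S ?Y"
    using y_third[OF d] by simp
  \<comment> \<open>Comparing the two ways to pass through \<open>?W\<close> determines \<open>?A\<close>.\<close>
  have 1: "?A + ?C \<approx> (1 - n d) *\<^sub>S ?Y"
    by (rule y_diagonal[OF d])
  \<comment> \<open>\<open>2\<close> and \<open>3\<close> are the diagonal relations for (a, d) and
    (d, c), multiplied by \<open>y * p c\<close> on the right and by \<open>p a * y\<close> on the
    left. \<open>D\<close> collapses the passage through \<open>d\<close> in every term except
    \<open>?W\<close>.\<close>
  have "p a * y * p a * y * p d * y * p c + ?W \<approx> (1 - n c) *\<^sub>S (p a * y * p d * y * p c)"
    using cong_right[OF y_diagonal[OF d'(1)], of "y * p c"] by (simp add: algebra_simps)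
  moreover have "p a * y * p a * y * p d * y * p c \<approx> n d *\<^sub>S ?A"
    using cong_left[OF D, of "p a * y"] by (simp add: mult.assoc)
  ultimately have 2: "n d *\<^sub>S ?A + ?W \<approx> ((1 - n c) * n d) *\<^sub>S ?Y"
    using cong_scale[OF D, of "1 - n c"] unfolding scale_scale by (blast intro: cong_replace2 cong_refl)
  have "?W + p a * y * p d * y * p c * y * p c \<approx> (1 - n a) *\<^sub>S (p a * y * p d * y * p c)"
    using cong_left[OF y_diagonal[OF d'(2)], of "p a * y"] by (simp add: algebra_simps)
  moreover have "p a * y * p d * y * p c * y * p c \<approx> n d *\<^sub>S ?C"
    using cong_right[OF D, of "y * p c"] by (simp add: mult.assoc)
  ultimately have 3: "?W + n d *\<^sub>S ?C \<approx> ((1 - n a) * n d) *\<^sub>S ?Y"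
    using cong_scale[OF D, of "1 - n a"] unfolding scale_scale by (blast intro: cong_replace2 cong_refl)
  have A: "?A \<approx> n a *\<^sub>S ?Y"
    using n n_nonzero[of d] by (intro eliminate_middle[OF 1 2 3]) auto
  have C: "?C \<approx> n c *\<^sub>S ?Y"
    using cong_diff[OF 1 A] by (simp add: n algebra_simps)
  show ?thesis
    using exhaust_distinct_3[OF d, of b] A C D by blast
qed

lemma multiple_off_diagonal:
  assumes "a \<noteq> b" "u \<in> {y, t}"
  shows "multiple (p a * y * p b) (p a * u * p b)"
  using ex_distinct_3[OF assms(1)] off_diagonal assms(2) by (metis insertE multiple_I multiple_refl singletonD)

text \<open>In the (a, b) component of \<open>yt\<close>, respectively \<open>ty\<close>, only one
  word has a diagonal \<open>t\<close>. The others are known multiples, so the equation is solved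
  for it.\<close>

lemma yt_middle:
  assumes "distinct [a, b, c]"
  shows "multiple (p a * y * p b) (p a * y * p b * t * p b)" (is "multiple ?Y _")
    and "multiple (p a * y * p b) (p a * t * p a * y * p b)"
proof -
  have d: "a \<noteq> b" "a \<noteq> c" "c \<noteq> b" using assms by auto
  have m: "multiple ?Y (p a * y * p e * y * p b)" for e
    using y_middle[OF d(1)] by (rule multiple_I)
  have "p a * y * p a * t * p b + p a * y * p b * t * p b + p a * y * p c * t * p b \<approx> 0"
    using cong_context[OF yt, of "p a" "p b"] peirce[OF assms, of a y t b] by simp
  from cong_diff[OF this cong_refl, of "p a * y * p a * t * p b + p a * y * p c * t * p b"]
  have "p a * y * p b * t * p b \<approx> - (p a * y * p a * t * p b) - p a * y * p c * t * p b"
    by (simp add: algebra_simps)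
  moreover have "multiple ?Y (p a * y * p a * t * p b)"
    using multiple_left[OF multiple_off_diagonal[OF d(1), of t], of "p a * y"] m[of a]
    by (simp add: mult.assoc multiple_trans)
  moreover have "multiple ?Y (p a * y * p c * t * p b)"
    using multiple_left[OF multiple_off_diagonal[OF d(3), of t], of "p a * y"] m[of c]
    by (simp add: mult.assoc multiple_trans)
  ultimately show "multiple ?Y (p a * y * p b * t * p b)"
    by (blast intro: multiple_cong multiple_diff multiple_minus)
  have "p a * t * p a * y * p b + p a * t * p b * y * p b + p a * t * p c * y * p b \<approx> 0"
    using cong_context[OF ty, of "p a" "p b"] peirce[OF assms, of a t y b] by simp
  from cong_diff[OF this cong_refl, of "p a * t * p b * y * p b + p a * t * p c * y * p b"]
  have "p a * t * p a * y * p b \<approx> - (p a * t * p b * y * p b) - p a * t * p c * y * p b"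
    by (simp add: algebra_simps)
  moreover have "multiple ?Y (p a * t * p b * y * p b)"
    using multiple_right[OF multiple_off_diagonal[OF d(1), of t], of "y * p b"] m[of b]
    by (simp add: mult.assoc multiple_trans)
  moreover have "multiple ?Y (p a * t * p c * y * p b)"
    using multiple_right[OF multiple_off_diagonal[OF d(2), of t], of "y * p b"] m[of c]
    by (simp add: mult.assoc multiple_trans)
  ultimately show "multiple ?Y (p a * t * p a * y * p b)"
    by (blast intro: multiple_cong multiple_diff multiple_minus)
qed

text \<open>An off-diagonal letter can be replaced by \<open>y\<close>. As
  \<open>a \<noteq> c\<close>, at most one of the two letters is diagonal, and if that one is
  \<open>t\<close>, \<open>yt_middle\<close> applies.\<close>

lemma multiple_middle:
  assumes "a \<noteq> c" "u \<in> {y, t}" "v \<in> {y, t}"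
  shows "multiple (p a * y * p c) (p a * u * p b * v * p c)"
proof -
  obtain d where d: "distinct [a, c, d]" using ex_distinct_3[OF assms(1)] .
  have m: "multiple (p a * y * p c) (p a * y * p e * y * p c)" for e
    using y_middle[OF assms(1)] by (rule multiple_I)
  show ?thesis
  proof (cases "b = c")
    case True
    have "multiple (p a * y * p c * v * p c) (p a * u * p c * v * p c)"
      using multiple_right[OF multiple_off_diagonal[OF assms(1,2)], of "v * p c"]
      by (simp add: mult.assoc)
    moreover have "multiple (p a * y * p c) (p a * y * p c * v * p c)"
      using yt_middle[OF d] m[of c] assms(3) by auto
    ultimately show ?thesis using True multiple_trans by blast
  next
    case False
    have v: "multiple (p a * u * p b * y * p c) (p a * u * p b * v * p c)"
      using multiple_left[OF multiple_off_diagonal[OF False assms(3)], of "p a * u"]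
      by (simp add: mult.assoc)
    have "multiple (p a * y * p c) (p a * u * p b * y * p c)"
    proof (cases "a = b")
      case True
      then show ?thesis using yt_middle[OF d] m[of b] assms(2) by auto
    next
      case False
      have "multiple (p a * y * p b * y * p c) (p a * u * p b * y * p c)"
        using multiple_right[OF multiple_off_diagonal[OF False assms(2)], of "y * p c"]
        by (simp add: mult.assoc)
      then show ?thesis using m[of b] multiple_trans by blast
    qed
    then show ?thesis using v multiple_trans by blast
  qed
qed

text \<open>The closed word \<open>p a * y * p c * y * p b * y * p a\<close> is shortened by
  \<open>y_middle\<close> in two ways, at \<open>c\<close> and at \<open>b\<close>.\<close>

lemma y_return:
  assumes "a \<noteq> b" "a \<noteq> c"
  shows "n c *\<^sub>S (p a * y * p b * y * p a) \<approx> n b *\<^sub>S (p a * y * p c * y * p a)"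
proof -
  have "p a * y * p c * y * p b * y * p a \<approx> n c *\<^sub>S (p a * y * p b * y * p a)"
    using cong_right[OF y_middle[OF assms(1), of c], of "y * p a"] by (simp add: mult.assoc)
  moreover have "p a * y * p c * y * p b * y * p a \<approx> n b *\<^sub>S (p a * y * p c * y * p a)"
    using cong_left[OF y_middle[OF assms(2)[symmetric], of b], of "p a * y"] by (simp add: mult.assoc)
  ultimately show ?thesis
    by (meson cong_sym cong_trans)
qed

lemma multiple_return:
  assumes "a \<noteq> b" "a \<noteq> c"
  shows "multiple (p a * y * p c * y * p a) (p a * y * p b * y * p a)"
proof (rule multiple_I)
  show "p a * y * p b * y * p a \<approx> (n b / n c) *\<^sub>S (p a * y * p c * y * p a)"
    by (rule cong_divide[OF n_nonzero y_return[OF assms]])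
qed

section \<open>The blocks span: closure under left multiplication\<close>

text \<open>Off-diagonal \<open>p a * t * p b\<close> are omitted as multiples of
  \<open>p a * y * p b\<close>. The two returns to each \<open>a\<close> are proportional modulo
  \<open>I\<close>, so up to proportionality there are 3 + 3 + 9 + 3 = 18 blocks.\<close>

definition blocks :: "'a set"
  where "blocks = range p \<union> range (\<lambda>a. p a * t * p a) \<union> {p a * y * p b |a b. True}
    \<union> {p a * y * p b * y * p a |a b. a \<noteq> b}"

text \<open>Including \<open>I\<close> makes this the preimage of the span of the blocks in the
  quotient.\<close>

definition V :: "'a set"
  where "V = span (I \<union> blocks)"

lemma
  shows subspace_V: "subspace V" and I_subset_V: "I \<subseteq> V" and blocks_subset_V: "blocks \<subseteq> V"
  using span_superset[of "I \<union> blocks"] by (simp_all add: V_def)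

lemma multiple_in_V: "multiple v a \<Longrightarrow> v \<in> V \<Longrightarrow> a \<in> V"
  using multiple_in_subspace subspace_V I_subset_V by blast

lemma cong_in_V: "a \<approx> v \<Longrightarrow> v \<in> V \<Longrightarrow> a \<in> V"
  by (rule multiple_in_V[of v]) (auto intro: multiple_I[of _ 1])

lemma blocks_in_V:
  "p a \<in> V" "u \<in> {y, t} \<Longrightarrow> p a * u * p b \<in> V" "a \<noteq> b \<Longrightarrow> p a * y * p b * y * p a \<in> V"
proof -
  show "p a \<in> V"
    using blocks_subset_V by (auto simp: blocks_def)
  show "p a * y * p b * y * p a \<in> V" if "a \<noteq> b"
    using that by (intro subsetD[OF blocks_subset_V]) (auto simp: blocks_def)
  have y: "p a * y * p b \<in> V" and t: "p a * t * p a \<in> V"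
    by (intro subsetD[OF blocks_subset_V]; force simp: blocks_def)+
  show "p a * u * p b \<in> V" if "u \<in> {y, t}"
    using that y t multiple_in_V[OF multiple_off_diagonal[OF _ that] y]
    by (cases "a = b") auto
qed

text \<open>Because the \<open>p a\<close> sum to 1. It reduces the products below to words that
  begin with an idempotent.\<close>

lemma in_V_by_components:
  assumes "\<And>a. p a * v \<in> V"
  shows "v \<in> V"
proof -
  have "v = (\<Sum>a\<in>UNIV. p a * v)" by (simp add: p_sum flip: sum_distrib_right)
  also have "\<dots> \<in> V" using assms by (intro subspace_sum subspace_V)
  finally show ?thesis .
qed

lemma p_left_V: "v \<in> blocks \<Longrightarrow> p a * v \<in> V"
proof -
  assume v: "v \<in> blocks"
  then have "\<exists>b w. v = p b * w"
    unfolding blocks_def by (auto simp: mult.assoc intro: exI[of _ 1]) (metis mult.right_neutral)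
  then obtain b w where w: "v = p b * w" by blast
  have m: "p a * v \<approx> (if a = b then p a else 0) * w"
    using cong_right[OF p_mult[of a b], of w] by (simp add: w mult.assoc)
  show ?thesis
  proof (cases "a = b")
    case True
    then have "p a * v \<approx> v" using m w by simp
    then show ?thesis by (rule cong_in_V[OF _ subsetD[OF blocks_subset_V v]])
  next
    case False
    then have "p a * v \<approx> 0" using m by simp
    then show ?thesis using subspace_0[OF subspace_V] by (rule cong_in_V)
  qed
qed

text \<open>For \<open>a \<noteq> b\<close> both letters are off-diagonal and turn into
  \<open>y\<close>. For \<open>a = b\<close> the Peirce expansion of
  \<open>p a * (u * v) * p a\<close> is solved for the term in question, \<open>u * v\<close> being
  congruent to \<open>u\<close> or 0.\<close>

lemma diagonal_in_V:
  assumes "u \<in> {y, t}" "v \<in> {y, t}"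
  shows "p a * u * p b * v * p a \<in> V"
proof -
  have off: "p a * u * p b * v * p a \<in> V" if "a \<noteq> b" for b
  proof -
    have "multiple (p a * y * p b * v * p a) (p a * u * p b * v * p a)"
      using multiple_right[OF multiple_off_diagonal[OF that assms(1)], of "v * p a"]
      by (simp add: mult.assoc)
    moreover have "multiple (p a * y * p b * y * p a) (p a * y * p b * v * p a)"
      using multiple_left[OF multiple_off_diagonal[OF that[symmetric] assms(2)], of "p a * y"]
      by (simp add: mult.assoc)
    ultimately show ?thesis using blocks_in_V(3)[OF that] multiple_in_V by blast
  qed
  show ?thesis
  proof (cases "a = b")
    case True
    obtain c where "a \<noteq> c" by (metis zero_neq_one)
    then obtain d where d: "distinct [a, c, d]" by (rule ex_distinct_3)
    have "u * v \<approx> (if u = v then u else 0)"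
      using assms yy tt yt ty by auto
    from cong_context[OF this, of "p a" "p a"] have "p a * (u * v) * p a \<in> V"
      using cong_in_V blocks_in_V(2)[OF assms(1)] subspace_0[OF subspace_V]
      by (auto split: if_splits)
    moreover have "p a * u * p a * v * p a
        = p a * (u * v) * p a - p a * u * p c * v * p a - p a * u * p d * v * p a"
      using peirce[OF d, of a u v a] by simp
    ultimately show ?thesis
      using True d off by (auto intro!: subspace_diff[OF subspace_V])
  qed (rule off)
qed

lemma q_left_V:
  assumes u: "u \<in> {y, t}" and "v \<in> blocks"
  shows "u * v \<in> V"
proof -
  have 1: "u * p a \<in> V" for a
    by (rule in_V_by_components) (use blocks_in_V(2)[OF u] in \<open>simp add: mult.assoc\<close>)
  have middle: "p e * u * p a * w * p b \<in> V" if w: "w \<in> {y, t}" for e a b w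
    using diagonal_in_V[OF u w, of b a] multiple_in_V[OF multiple_middle[OF _ u w] blocks_in_V(2)[of y]]
    by (cases "e = b") auto
  have 2: "u * (p a * w * p b) \<in> V" if w: "w \<in> {y, t}" for a b w
    by (rule in_V_by_components) (use middle[OF w] in \<open>simp add: mult.assoc\<close>)
  have 3: "p e * u * p a * y * p b * y * p a \<in> V" if ab: "a \<noteq> b" for e a b
  proof (cases "e = b")
    case False
    have "multiple (p e * y * p b * y * p a) (p e * u * p a * y * p b * y * p a)"
      using multiple_right[OF multiple_middle[OF False u, of y a], of "y * p a"] by (simp add: mult.assoc)
    moreover have "p e * y * p b * y * p a \<in> V"
      using diagonal_in_V[of y y e b] multiple_in_V[OF multiple_middle[of e a y y b] blocks_in_V(2)[of y]]
      by (cases "e = a") auto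
    ultimately show ?thesis by (rule multiple_in_V)
  next
    \<comment> \<open>Now \<open>p b * u * p a * y * p b\<close> is a return to \<open>b\<close>,
      out of reach of \<open>multiple_middle\<close>. So \<open>multiple_return\<close> first moves
      the later passage from \<open>b\<close> to the third index \<open>c\<close>.\<close>
    case True
    obtain c where c: "distinct [a, b, c]" using ex_distinct_3[OF ab] .
    have "multiple (p e * u * p a * y * p c * y * p a) (p e * u * p a * y * p b * y * p a)"
      using multiple_left[OF multiple_return[OF ab, of c], of "p e * u"] c by (simp add: mult.assoc)
    moreover have "multiple (p e * y * p c * y * p a) (p e * u * p a * y * p c * y * p a)"
      using multiple_right[OF multiple_middle[OF _ u, of e c y a], of "y * p a"] c True by (simp add: mult.assoc)
    moreover have "p e * y * p c * y * p a \<in> V"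
      using multiple_in_V[OF multiple_middle[of e a y y c] blocks_in_V(2)[of y]] True ab by auto
    ultimately show ?thesis using multiple_in_V by blast
  qed
  have 4: "u * (p a * y * p b * y * p a) \<in> V" if "a \<noteq> b" for a b
    by (rule in_V_by_components) (use 3[OF that] in \<open>simp add: mult.assoc\<close>)
  show ?thesis
    using assms(2) 1 2 4 by (auto simp: blocks_def)
qed

lemma left_V:
  assumes u: "u \<in> range p \<union> {y, t}" and v: "v \<in> V"
  shows "u * v \<in> V"
proof -
  have "subspace {v. u * v \<in> V}"
    using subspace_V by (auto simp: subspace_def distrib_left)
  moreover have "I \<union> blocks \<subseteq> {v. u * v \<in> V}"
    using mult_left_I I_subset_V p_left_V q_left_V u by auto
  ultimately have "V \<subseteq> {v. u * v \<in> V}"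
    by (subst V_def) (rule span_minimal)
  with v show ?thesis by blast
qed

lemma V_minimal: "subspace W \<Longrightarrow> I \<subseteq> W \<Longrightarrow> blocks \<subseteq> W \<Longrightarrow> V \<subseteq> W"
  unfolding V_def by (simp add: span_minimal)

lemma one_in_V: "1 \<in> V"
  by (rule in_V_by_components) (simp add: blocks_in_V)

end

section \<open>Evaluation of polynomials and Zariski-open sets\<close>

lemma poly_mapping_additive_induct [case_names single add]:
  fixes f :: "'w \<Rightarrow>\<^sub>0 'k::comm_monoid_add"
  assumes single: "\<And>w c. R (Poly_Mapping.single w c)"
    and add: "\<And>f g. R f \<Longrightarrow> R g \<Longrightarrow> R (f + g)"
  shows "R f"
proof -
  have f: "f = (\<Sum>w\<in>Poly_Mapping.keys f. Poly_Mapping.single w (Poly_Mapping.lookup f w))"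
    by (rule poly_mapping_eqI)
       (simp add: lookup_sum lookup_single when_def sum.delta in_keys_iff)
  have "R (\<Sum>w\<in>A. Poly_Mapping.single w (Poly_Mapping.lookup f w))" if "finite A" for A
    using that by induction (use single[of undefined 0] in \<open>auto intro: single add\<close>)
  then show ?thesis by (subst f) simp
qed

text \<open>The universal property of a monoid algebra. The operations are parameters because the
  same extension serves polynomial evaluation, \<open>'k ^ 9\<close> and matrices, where the
  type-class product would be componentwise.\<close>

locale linear_extension =
  fixes smul :: "'k::field \<Rightarrow> 'b::ab_group_add \<Rightarrow> 'b" and mul :: "'b \<Rightarrow> 'b \<Rightarrow> 'b"
    and ev :: "'w::monoid_add \<Rightarrow> 'b"
  assumes smul_left_distrib: "smul (c + d) a = smul c a + smul d a"
    and mul_left_distrib: "mul (a + b) e = mul a e + mul b e"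
    and mul_right_distrib: "mul a (b + e) = mul a b + mul a e"
    and mul_smul: "mul (smul c a) (smul d b) = smul (c * d) (mul a b)"
    and ev_plus: "ev (u + v) = mul (ev u) (ev v)"
begin

definition ext :: "('w \<Rightarrow>\<^sub>0 'k) \<Rightarrow> 'b"
  where "ext f = (\<Sum>w\<in>Poly_Mapping.keys f. smul (Poly_Mapping.lookup f w) (ev w))"

lemma smul_0 [simp]: "smul 0 a = 0"
  using smul_left_distrib[of 0 0 a] by simp

lemma ext_single [simp]: "ext (Poly_Mapping.single w c) = smul c (ev w)"
  by (simp add: ext_def)

lemma ext_add: "ext (f + g) = ext f + ext g"
  unfolding ext_def by (rule setsum_keys_plus_distrib) (simp_all add: smul_left_distrib)

lemma ext_diff: "ext (f - g) = ext f - ext g"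
  using ext_add[of "f - g" g] by simp

lemma ext_0 [simp]: "ext 0 = 0"
  by (simp add: ext_def)

lemma ext_sum: "ext (sum h A) = (\<Sum>a\<in>A. ext (h a))"
  by (induction A rule: infinite_finite_induct) (simp_all add: ext_add)

lemma ext_mult: "ext (f * g) = mul (ext f) (ext g)"
proof (induction f rule: poly_mapping_additive_induct)
  case (single u c)
  show ?case
    by (induction g rule: poly_mapping_additive_induct)
       (simp_all add: mult_single mul_smul ev_plus distrib_left ext_add mul_right_distrib)
next
  case (add f g)
  then show ?case by (simp add: distrib_right ext_add mul_left_distrib)
qed

end

lemma linear_extension_eval:
  "linear_extension (*) (*) (\<lambda>m. \<Prod>v\<in>UNIV. x $ v ^ Poly_Mapping.lookup m v :: 'k::field)"
  by standard (simp_all add: algebra_simps lookup_add power_add prod.distrib)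

lemma eval_mpoly_eq_ext:
  "eval_mpoly f x = linear_extension.ext (*) (\<lambda>m. \<Prod>v\<in>UNIV. x $ v ^ Poly_Mapping.lookup m v) f"
  by (simp add: eval_mpoly_def linear_extension.ext_def[OF linear_extension_eval])

lemma eval_mpoly_mult: "eval_mpoly (f * g) x = eval_mpoly f x * eval_mpoly g x"
  and eval_mpoly_diff: "eval_mpoly (f - g) x = eval_mpoly f x - eval_mpoly g x"
  by (simp_all add: eval_mpoly_eq_ext linear_extension.ext_mult[OF linear_extension_eval]
      linear_extension.ext_diff[OF linear_extension_eval])

text \<open>Speaking of the function and not of the polynomial allows a form to be written as an
  ordinary expression in the coordinates.\<close>

definition is_form :: "nat \<Rightarrow> ('k::field ^ 'n::finite \<Rightarrow> 'k) \<Rightarrow> bool"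
  where "is_form d h \<longleftrightarrow> (\<exists>f. homogeneous d f \<and> (\<forall>x. eval_mpoly f x = h x))"

lemma is_form_coordinate: "is_form 1 (\<lambda>x :: 'k::field ^ 'n::finite. x $ v)"
  unfolding is_form_def
proof (intro exI conjI allI)
  let ?f = "Poly_Mapping.single (Poly_Mapping.single v 1) 1 :: ('k, 'n) mpolynomial"
  show "homogeneous 1 ?f"
    by (simp add: homogeneous_def lookup_single when_def)
  show "eval_mpoly ?f x = x $ v" for x
    by (simp add: eval_mpoly_def lookup_single when_def if_distrib prod.delta cong: if_cong)
qed

lemma is_form_mult:
  fixes g h :: "'k::field ^ 'n::finite \<Rightarrow> 'k"
  assumes "is_form d g" "is_form e h"
  shows "is_form (d + e) (\<lambda>x. g x * h x)"
proof -
  obtain f1 f2 where f: "homogeneous d f1" "homogeneous e f2"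
    "\<And>x. eval_mpoly f1 x = g x" "\<And>x. eval_mpoly f2 x = h x"
    using assms unfolding is_form_def by metis
  have "homogeneous (d + e) (f1 * f2)"
    using f(1,2) keys_mult[of f1 f2] by (fastforce simp: homogeneous_def lookup_add sum.distrib)
  moreover have "eval_mpoly (f1 * f2) x = g x * h x" for x
    by (simp add: eval_mpoly_mult f(3,4))
  ultimately show ?thesis unfolding is_form_def by blast
qed

lemma is_form_diff:
  fixes g h :: "'k::field ^ 'n::finite \<Rightarrow> 'k"
  assumes "is_form d g" "is_form d h"
  shows "is_form d (\<lambda>x. g x - h x)"
proof -
  obtain f1 f2 where f: "homogeneous d f1" "homogeneous d f2"
    "\<And>x. eval_mpoly f1 x = g x" "\<And>x. eval_mpoly f2 x = h x"
    using assms unfolding is_form_def by metis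
  have "homogeneous d (f1 - f2)"
    using f(1,2) keys_diff[of f1 f2] by (fastforce simp: homogeneous_def)
  moreover have "eval_mpoly (f1 - f2) x = g x - h x" for x
    by (simp add: eval_mpoly_diff f(3,4))
  ultimately show ?thesis unfolding is_form_def by blast
qed

lemma is_form_scale:
  assumes "is_form d h"
  shows "h (c *s x) = c ^ d * h x"
proof -
  obtain f where f: "homogeneous d f" "\<And>x. h x = eval_mpoly f x"
    using assms unfolding is_form_def by metis
  show ?thesis
    unfolding f(2) eval_mpoly_def sum_distrib_left
  proof (rule sum.cong[OF refl])
    fix m assume "m \<in> Poly_Mapping.keys f"
    then have "(\<Sum>v\<in>UNIV. Poly_Mapping.lookup m v) = d"
      using f(1) by (simp add: homogeneous_def)
    then show "Poly_Mapping.lookup f m * (\<Prod>v\<in>UNIV. (c *s x) $ v ^ Poly_Mapping.lookup m v)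
      = c ^ d * (Poly_Mapping.lookup f m * (\<Prod>v\<in>UNIV. x $ v ^ Poly_Mapping.lookup m v))"
      by (simp add: power_mult_distrib prod.distrib flip: power_sum)
  qed
qed

text \<open>Rescaling the vector multiplies \<open>h\<close> by a power of the scalar, so
  nonvanishing passes from one representative to any other.\<close>

lemma proj_point_in_nonvanishing_set:
  assumes "is_form d h" "proj_point x \<in> {proj_point y |y. y \<noteq> 0 \<and> h y \<noteq> 0}"
  shows "h x \<noteq> 0"
proof -
  obtain y where y: "h y \<noteq> 0" "proj_point x = proj_point y" using assms(2) by auto
  moreover have "y \<in> proj_point y"
    unfolding proj_point_def by (auto intro!: exI[of _ 1])
  ultimately obtain c where "y = c *s x"
    by (auto simp: proj_point_def)
  with y(1) show ?thesis using is_form_scale[OF assms(1)] by auto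
qed

lemma zariski_open_nonvanishing_set:
  assumes "is_form d h"
  shows "zariski_open {proj_point x |x. x \<noteq> 0 \<and> h x \<noteq> 0}" (is "zariski_open ?U")
proof -
  obtain f where f: "homogeneous d f" "\<And>x. eval_mpoly f x = h x"
    using assms unfolding is_form_def by metis
  have "proj_space - ?U = {proj_point x |x. x \<noteq> 0 \<and> (\<forall>f\<in>{f}. eval_mpoly f x = 0)}"
    using proj_point_in_nonvanishing_set[OF assms] by (auto simp: proj_space_def f(2))
  then have "zariski_closed (proj_space - ?U)"
    unfolding zariski_closed_def using f(1) by blast
  then show ?thesis by (auto simp: zariski_open_def proj_space_def)
qed

section \<open>The relations of \<open>S\<^sub>x\<close> at a generic point\<close>

lemma scalar_commute: "f * scalar c = scalar c * f"
  by (induction f rule: poly_mapping_additive_induct)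
     (simp_all add: scalar_def mult_single mult.commute distrib_left distrib_right)

lemma scalar_0 [simp]: "scalar 0 = 0"
  by (simp add: scalar_def)

lemma presented_algebra_ideal: "ideal (Idl\<^bsub>free_algebra\<^esub> R) free_algebra"
  by (rule ring.genideal_ideal[OF ring_free_algebra]) simp

lemma relations_in_ideal: "r \<in> R \<Longrightarrow> r \<in> Idl\<^bsub>free_algebra\<^esub> R"
  using ring.genideal_self[OF ring_free_algebra, of R] by auto

lemma free_algebra_congruence:
  fixes R :: "('k::field, 'g) free_alg set"
  shows "algebra_congruence (\<lambda>c f. scalar c * f) (Idl\<^bsub>free_algebra\<^esub> R)"
proof -
  let ?I = "Idl\<^bsub>free_algebra\<^esub> R"
  interpret I: ideal ?I free_algebra by (rule presented_algebra_ideal)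
  interpret vector_space "\<lambda>c (f :: ('k, 'g) free_alg). scalar c * f"
    by standard (simp_all add: scalar_simps distrib_left distrib_right mult.assoc)
  have left: "b * a \<in> ?I" and right: "a * b \<in> ?I" if "a \<in> ?I" for a b
    using I.I_l_closed[OF that, of b] I.I_r_closed[OF that, of b] by (simp_all add: free_algebra_def)
  have "0 \<in> ?I"
    using additive_subgroup.zero_closed[OF I.additive_subgroup_axioms] by (simp add: free_algebra_def)
  moreover have "a + b \<in> ?I" if "a \<in> ?I" "b \<in> ?I" for a b
    using additive_subgroup.a_closed[OF I.additive_subgroup_axioms that] by (simp add: free_algebra_def)
  ultimately have sub: "subspace ?I"
    using left by (simp add: subspace_def)
  show ?thesis
    by standard (use sub left right in \<open>simp_all add: mult.assoc, simp add: scalar_commute flip: mult.assoc\<close>)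
qed

text \<open>Supplies the relations of the third idempotent from those of the first two.\<close>

lemma (in algebra_congruence) complement_idempotent:
  assumes "e * e \<approx> e" "f * f \<approx> f" "e * f \<approx> 0" "f * e \<approx> 0"
  shows "e * (1 - e - f) \<approx> 0" "(1 - e - f) * e \<approx> 0"
    "f * (1 - e - f) \<approx> 0" "(1 - e - f) * f \<approx> 0"
    "(1 - e - f) * (1 - e - f) \<approx> 1 - e - f"
proof -
  show 1: "e * (1 - e - f) \<approx> 0"
    using cong_diff[OF cong_diff[OF cong_refl[of e] assms(1)] assms(3)] by (simp add: algebra_simps)
  show "(1 - e - f) * e \<approx> 0"
    using cong_diff[OF cong_diff[OF cong_refl[of e] assms(1)] assms(4)] by (simp add: algebra_simps)
  show 2: "f * (1 - e - f) \<approx> 0"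
    using cong_diff[OF cong_diff[OF cong_refl[of f] assms(2)] assms(4)] by (simp add: algebra_simps)
  show "(1 - e - f) * f \<approx> 0"
    using cong_diff[OF cong_diff[OF cong_refl[of f] assms(2)] assms(3)] by (simp add: algebra_simps)
  show "(1 - e - f) * (1 - e - f) \<approx> 1 - e - f"
    using cong_diff[OF cong_diff[OF cong_refl[of "1 - e - f"] 1] 2] by (simp add: left_diff_distrib)
qed

text \<open>Row \<open>3\<close> of the coefficient matrix, which belongs to \<open>p\<^sub>3 = 1 - p\<^sub>1 - p\<^sub>2\<close>, is zero.\<close>

definition coord :: "'k::field ^ (2 \<times> 2) \<Rightarrow> 3 \<Rightarrow> 2 \<Rightarrow> 'k"
  where "coord x a j = (if a = 1 then x $ (1, j) else if a = 2 then x $ (2, j) else 0)"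

text \<open>The scalar by which \<open>p\<^sub>a q\<^sub>2 p\<^sub>b\<close> must be multiplied to
  give \<open>p\<^sub>a q\<^sub>1 p\<^sub>b\<close>, as read off from the commutator relation. It is
  minus the usual slope of the line through the points given by rows \<open>a\<close> and
  \<open>b\<close>.\<close>

definition slope :: "'k::field ^ (2 \<times> 2) \<Rightarrow> 3 \<Rightarrow> 3 \<Rightarrow> 'k"
  where "slope x a b = - (coord x a 2 - coord x b 2) / (coord x a 1 - coord x b 1)"

text \<open>The scalar \<open>s\<^sub>c\<close> belongs to the two indices other than \<open>c\<close>.\<close>

definition opposite_slope :: "'k::field ^ (2 \<times> 2) \<Rightarrow> 3 \<Rightarrow> 'k"
  where "opposite_slope x c = (if c = 1 then slope x 2 3 else if c = 2 then slope x 1 3 else slope x 1 2)"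

lemma slope_sym: "slope x a b = slope x b a"
  unfolding slope_def by (metis minus_diff_eq minus_divide_divide)

lemma opposite_slope_eq:
  assumes "distinct [a, b, c]"
  shows "opposite_slope x c = slope x a b"
  using assms exhaust_3[of a] exhaust_3[of b] exhaust_3[of c]
  by (auto simp: opposite_slope_def slope_sym[of x 3] slope_sym[of x 2 1] slope_sym[of x 0])

text \<open>The rows of \<open>coord x\<close> are three points of the plane, the third being the
  origin. The first condition makes the slopes well defined and nonzero, the second keeps them away
  from -1, and the third makes the points non-collinear, hence the slopes distinct.\<close>

locale generic_point =
  fixes x :: "'k::field_char_0 ^ (2 \<times> 2)"
  assumes coord_neq: "a \<noteq> b \<Longrightarrow> coord x a j \<noteq> coord x b j"
    and coord_diff_neq: "a \<noteq> b \<Longrightarrow> coord x a 1 - coord x b 1 \<noteq> coord x a 2 - coord x b 2"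
    and det_nonzero: "x $ (1, 1) * x $ (2, 2) \<noteq> x $ (1, 2) * x $ (2, 1)"
begin

text \<open>The difference of the two sides is the determinant with rows
  \<open>(coord x a 1, coord x a 2, 1)\<close> and likewise for \<open>b\<close>, \<open>c\<close>.
  Permuting the rows changes only its sign, and row 3 is \<open>(0, 0, 1)\<close>.\<close>

lemma det_differences:
  assumes "distinct [a, b, c]"
  shows "(coord x a 1 - coord x c 1) * (coord x b 2 - coord x c 2)
    \<noteq> (coord x b 1 - coord x c 1) * (coord x a 2 - coord x c 2)"
proof -
  have "(coord x a 1 - coord x c 1) * (coord x b 2 - coord x c 2)
      - (coord x b 1 - coord x c 1) * (coord x a 2 - coord x c 2)
    \<in> {x $ (1, 1) * x $ (2, 2) - x $ (1, 2) * x $ (2, 1),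
       - (x $ (1, 1) * x $ (2, 2) - x $ (1, 2) * x $ (2, 1))}"
    using assms exhaust_3[of a] exhaust_3[of b] exhaust_3[of c]
    by (auto simp: coord_def algebra_simps)
  then show ?thesis using det_nonzero by auto
qed

sublocale S_parameters "opposite_slope x"
proof
  fix a b :: 3
  have "a \<noteq> a + 1" by simp
  then obtain d where "distinct [a, a + 1, d]" by (rule ex_distinct_3)
  then obtain c where c: "distinct [c, d, a]" by (auto intro: that[of "a + 1"])
  then have "c \<noteq> d" by auto
  then show "opposite_slope x a \<noteq> 0"
    using coord_neq[of c d 1] coord_neq[of c d 2] by (simp add: opposite_slope_eq[OF c] slope_def)
  show "opposite_slope x a + 1 \<noteq> 0"
    using \<open>c \<noteq> d\<close> coord_neq[of c d 1] coord_diff_neq[of c d]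
    by (simp add: opposite_slope_eq[OF c] slope_def field_simps)
  assume "a \<noteq> b"
  then obtain c where "distinct [a, b, c]" by (rule ex_distinct_3)
  then have d: "distinct [b, c, a]" "distinct [a, c, b]" "distinct [a, b, c]" "a \<noteq> c" "b \<noteq> c" by auto
  show "opposite_slope x a \<noteq> opposite_slope x b"
  proof
    \<comment> \<open>These are slopes of two lines through the common point \<open>c\<close>;
      equality would make the three points collinear.\<close>
    assume "opposite_slope x a = opposite_slope x b"
    then have "(coord x b 2 - coord x c 2) / (coord x b 1 - coord x c 1)
        = (coord x a 2 - coord x c 2) / (coord x a 1 - coord x c 1)"
      unfolding opposite_slope_eq[OF d(1)] opposite_slope_eq[OF d(2)] slope_def
      by (simp only: minus_divide_left[symmetric] neg_equal_iff_equal)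
    with det_differences[OF d(3)] coord_neq[OF d(4), of 1] coord_neq[OF d(5), of 1]
    show False by (simp add: frac_eq_eq mult.commute)
  qed
qed

end

definition idem_P :: "3 \<Rightarrow> ('k::field, S_gen) free_alg"
  where "idem_P a = (if a = 1 then gen (P 1) else if a = 2 then gen (P 2) else 1 - gen (P 1) - gen (P 2))"

lemma S_relation_mult:
  "gen (P i) * gen (P j) - (if i = j then gen (P i) else 0) \<in> S_relations x"
  "gen (Q i) * gen (Q j) - (if i = j then gen (Q i) else 0) \<in> S_relations x"
  by (auto simp: S_relations_def)

text \<open>Grouping by \<open>j\<close> gives commutators with \<open>D j\<close>, which acts on
  \<open>idem_P a\<close> as the scalar \<open>coord x a j\<close>; see
  \<open>idem_P_diagonal\<close>.\<close>

lemma S_relation_commutators: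
  fixes x :: "'k::field ^ (2 \<times> 2)"
  defines "D \<equiv> \<lambda>j. scalar (x $ (1, j)) * gen (P 1) + scalar (x $ (2, j)) * gen (P 2)"
  shows "(D 1 * gen (Q 1) - gen (Q 1) * D 1) + (D 2 * gen (Q 2) - gen (Q 2) * D 2) \<in> S_relations x"
proof -
  have "gen (Q j) * (scalar c * f) = scalar c * (gen (Q j) * f)" for j c and f :: "('k, S_gen) free_alg"
    by (simp add: scalar_commute flip: mult.assoc)
  then have "(D 1 * gen (Q 1) - gen (Q 1) * D 1) + (D 2 * gen (Q 2) - gen (Q 2) * D 2)
    = (\<Sum>i\<in>UNIV. \<Sum>j\<in>UNIV. scalar (x $ (i, j)) * (gen (P i) * gen (Q j) - gen (Q j) * gen (P i)))"
    unfolding sum_2 D_def by (simp add: distrib_left distrib_right right_diff_distrib mult.assoc)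
  then show ?thesis by (auto simp: S_relations_def)
qed

context generic_point
begin

abbreviation "relation_ideal \<equiv> Idl\<^bsub>free_algebra\<^esub> (S_relations x)"

sublocale F: algebra_congruence "\<lambda>c f. scalar c * f" relation_ideal
  by (rule free_algebra_congruence)

lemma relation_cong: "a - b \<in> S_relations x \<Longrightarrow> F.cong a b"
  unfolding F.cong_def by (rule relations_in_ideal)

lemma idem_P_mult: "F.cong (idem_P a * idem_P b) (if a = b then idem_P a else 0)"
proof -
  note P = relation_cong[OF S_relation_mult(1)]
  have P': "F.cong (gen (P 1) * gen (P 1)) (gen (P 1))" "F.cong (gen (P 2) * gen (P 2)) (gen (P 2))"
    "F.cong (gen (P 1) * gen (P 2)) 0" "F.cong (gen (P 2) * gen (P 1)) 0"
    using P[of 1 1] P[of 2 2] P[of 1 2] P[of 2 1] by simp_all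
  show ?thesis
    using exhaust_3[of a] exhaust_3[of b] P' F.complement_idempotent[OF P'(1,2,3,4)]
    by (auto simp: idem_P_def)
qed

lemma idem_P_diagonal:
  fixes j :: 2
  defines "D \<equiv> scalar (x $ (1, j)) * gen (P 1) + scalar (x $ (2, j)) * gen (P 2)"
  shows "F.cong (idem_P a * D) (scalar (coord x a j) * idem_P a)"
    "F.cong (D * idem_P a) (scalar (coord x a j) * idem_P a)"
proof -
  have D: "D = scalar (x $ (1, j)) * idem_P 1 + scalar (x $ (2, j)) * idem_P 2"
    by (simp add: D_def idem_P_def)
  have "F.cong (idem_P a * D) (scalar (x $ (1, j)) * (if a = 1 then idem_P a else 0)
      + scalar (x $ (2, j)) * (if a = 2 then idem_P a else 0))"
    unfolding D distrib_left F.scale_mult_right by (intro F.cong_add F.cong_scale idem_P_mult)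
  then show "F.cong (idem_P a * D) (scalar (coord x a j) * idem_P a)"
    by (auto simp: coord_def split: if_splits)
  have "F.cong (D * idem_P a) (scalar (x $ (1, j)) * (if 1 = a then idem_P 1 else 0)
      + scalar (x $ (2, j)) * (if 2 = a then idem_P 2 else 0))"
    unfolding D distrib_right F.scale_mult_left by (intro F.cong_add F.cong_scale idem_P_mult)
  then show "F.cong (D * idem_P a) (scalar (coord x a j) * idem_P a)"
    by (auto simp: coord_def split: if_splits)
qed

text \<open>Between \<open>idem_P a\<close> and \<open>idem_P b\<close>, the commutator of
  \<open>?D j\<close> with \<open>gen (Q j)\<close> becomes \<open>gen (Q j)\<close> times the
  difference of the two eigenvalues. The one for \<open>j = 1\<close> is nonzero and is divided
  out.\<close>

lemma off_diagonal_relation: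
  assumes "distinct [a, b, c]"
  shows "F.cong (idem_P a * gen (Q 1) * idem_P b)
    (scalar (opposite_slope x c) * (idem_P a * gen (Q 2) * idem_P b))"
proof -
  let ?D = "\<lambda>j. scalar (x $ (1, j)) * gen (P 1) + scalar (x $ (2, j)) * gen (P 2)"
  have comm: "F.cong (idem_P a * (?D j * gen (Q j) - gen (Q j) * ?D j) * idem_P b)
     (scalar (coord x a j - coord x b j) * (idem_P a * gen (Q j) * idem_P b))" for j
    using F.cong_diff[OF F.cong_right[OF idem_P_diagonal(1)[of a j], of "gen (Q j) * idem_P b"]
        F.cong_left[OF idem_P_diagonal(2)[of j b], of "idem_P a * gen (Q j)"]]
    unfolding F.scale_mult_right F.scale_mult_left F.scale_left_diff_distrib
    by (simp only: mult.assoc left_diff_distrib right_diff_distrib)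
  have "F.cong (?D 1 * gen (Q 1) - gen (Q 1) * ?D 1 + (?D 2 * gen (Q 2) - gen (Q 2) * ?D 2)) 0"
    using relation_cong[of _ 0] S_relation_commutators[of x] by simp
  from F.cong_context[OF this, of "idem_P a" "idem_P b"]
  have "F.cong (idem_P a * (?D 1 * gen (Q 1) - gen (Q 1) * ?D 1) * idem_P b
      + idem_P a * (?D 2 * gen (Q 2) - gen (Q 2) * ?D 2) * idem_P b) 0"
    by (simp only: distrib_left distrib_right mult_zero_left mult_zero_right)
  from F.cong_replace2[OF this comm comm F.cong_refl]
  have "F.cong (scalar (coord x a 1 - coord x b 1) * (idem_P a * gen (Q 1) * idem_P b)
     + scalar (coord x a 2 - coord x b 2) * (idem_P a * gen (Q 2) * idem_P b)) 0" .
  from F.cong_diff[OF this F.cong_refl[of "scalar (coord x a 2 - coord x b 2) * (idem_P a * gen (Q 2) * idem_P b)"]]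
  have "F.cong (scalar (coord x a 1 - coord x b 1) * (idem_P a * gen (Q 1) * idem_P b))
     (scalar (- (coord x a 2 - coord x b 2)) * (idem_P a * gen (Q 2) * idem_P b))"
    by (simp only: F.scale_minus_left add_diff_cancel_right' diff_0)
  then show ?thesis
    using coord_neq[of a b 1] assms unfolding opposite_slope_eq[OF assms] slope_def
    by (intro F.cong_divide) auto
qed

sublocale S_congruence "\<lambda>c f. scalar c * f" relation_ideal "opposite_slope x" idem_P "gen (Q 1)" "gen (Q 2)"
proof
  note Q = relation_cong[OF S_relation_mult(2)]
  show "F.cong (gen (Q 2) * gen (Q 2)) (gen (Q 2))" "F.cong (gen (Q 1) * gen (Q 1)) (gen (Q 1))"
    "F.cong (gen (Q 1) * gen (Q 2)) 0" "F.cong (gen (Q 2) * gen (Q 1)) 0"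
    using Q[of 1 1] Q[of 2 2] Q[of 1 2] Q[of 2 1] by simp_all
  show "sum idem_P UNIV = 1"
    unfolding sum_3 by (simp add: idem_P_def)
qed (use idem_P_mult off_diagonal_relation in auto)

lemma gen_left_V:
  assumes "v \<in> V"
  shows "gen g * v \<in> V"
proof (cases g)
  case (P i)
  have "gen (P i) \<in> range idem_P"
    using exhaust_2[of i] rangeI[of idem_P 1] rangeI[of idem_P 2] by (auto simp: idem_P_def)
  then show ?thesis using left_V assms P by blast
next
  case (Q j)
  then show ?thesis using left_V[OF _ assms] exhaust_2[of j] by auto
qed

text \<open>\<open>V\<close> contains 1 and is stable under left multiplication by generators, hence
  by words and by linear combinations. This is the upper bound on the quotient.\<close>

lemma V_eq_UNIV: "V = UNIV"
proof -
  have "f * v \<in> V" if "v \<in> V" for f v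
  proof (induction f rule: poly_mapping_additive_induct)
    case (single w c)
    have "Poly_Mapping.single (Word gs) c * v \<in> V" for gs
    proof (induction gs)
      case Nil
      have "Poly_Mapping.single (Word []) c = scalar c"
        by (simp add: scalar_def zero_free_monoid_def)
      then show ?case using F.subspace_scale[OF subspace_V that, of c] by metis
    next
      case (Cons g gs)
      have "Poly_Mapping.single (Word (g # gs)) c = gen g * Poly_Mapping.single (Word gs) c"
        by (simp add: gen_def mult_single plus_free_monoid_def)
      then show ?case using gen_left_V[OF Cons.IH, of g] by (simp add: mult.assoc)
    qed
    then show ?case by (cases w) simp
  next
    case (add f g)
    then show ?case using F.subspace_add[OF subspace_V] by (simp add: distrib_right)
  qed
  from this[OF one_in_V] show ?thesis by auto
qed

end

section \<open>Presented algebras and matrix algebras\<close>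

lemma presented_algebra_carrier:
  "carrier (presented_algebra R) = range (\<lambda>f. (Idl\<^bsub>free_algebra\<^esub> R) +>\<^bsub>free_algebra\<^esub> f)"
  by (auto simp: presented_algebra_def quotient_algebra_def ring.defs FactRing_def A_RCOSETS_def')

lemma coset_eq_iff:
  fixes f g :: "('k::field, 'g) free_alg"
  shows "(Idl\<^bsub>free_algebra\<^esub> R) +>\<^bsub>free_algebra\<^esub> f = (Idl\<^bsub>free_algebra\<^esub> R) +>\<^bsub>free_algebra\<^esub> g
    \<longleftrightarrow> f - g \<in> Idl\<^bsub>free_algebra\<^esub> R" (is "?I +>\<^bsub>_\<^esub> f = _ \<longleftrightarrow> _")
proof -
  interpret I: ideal ?I free_algebra by (rule presented_algebra_ideal)
  have coset: "h \<in> ?I +>\<^bsub>free_algebra\<^esub> g \<longleftrightarrow> h - g \<in> ?I" for h g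
    by (auto simp: a_r_coset_def' free_algebra_def intro: bexI[of _ "h - g"])
  show ?thesis
    unfolding coset[symmetric] using I.a_repr_independence'[of f g] I.a_rcos_self[of f] by auto
qed

lemma presented_algebra_add:
  "((Idl\<^bsub>free_algebra\<^esub> R) +>\<^bsub>free_algebra\<^esub> f) \<oplus>\<^bsub>presented_algebra R\<^esub> ((Idl\<^bsub>free_algebra\<^esub> R) +>\<^bsub>free_algebra\<^esub> g)
    = (Idl\<^bsub>free_algebra\<^esub> R) +>\<^bsub>free_algebra\<^esub> (f + g)"
proof -
  interpret I: ideal "Idl\<^bsub>free_algebra\<^esub> R" free_algebra by (rule presented_algebra_ideal)
  show ?thesis
    using I.a_rcos_sum[of f g]
    by (simp add: presented_algebra_def quotient_algebra_def ring.defs FactRing_def)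
       (simp add: free_algebra_def)
qed

lemma presented_algebra_smult:
  fixes f :: "('k::field, 'g) free_alg"
  shows "c \<odot>\<^bsub>presented_algebra R\<^esub> ((Idl\<^bsub>free_algebra\<^esub> R) +>\<^bsub>free_algebra\<^esub> f)
    = (Idl\<^bsub>free_algebra\<^esub> R) +>\<^bsub>free_algebra\<^esub> (scalar c * f)" (is "_ = ?I +>\<^bsub>_\<^esub> _")
proof -
  interpret I: ideal ?I free_algebra by (rule presented_algebra_ideal)
  interpret C: algebra_congruence "\<lambda>c f. scalar c * f" ?I by (rule free_algebra_congruence)
  have eq: "?I +>\<^bsub>free_algebra\<^esub> (scalar c * g) = ?I +>\<^bsub>free_algebra\<^esub> (scalar c * f)"
    if "g \<in> ?I +>\<^bsub>free_algebra\<^esub> f" for g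
  proof -
    from that have "g - f \<in> ?I" by (auto simp: a_r_coset_def' free_algebra_def)
    then show ?thesis
      unfolding coset_eq_iff using C.subspace_scale[OF C.subspace_I] by (metis right_diff_distrib)
  qed
  have "c \<odot>\<^bsub>presented_algebra R\<^esub> (?I +>\<^bsub>free_algebra\<^esub> f)
      = (\<Union>g\<in>?I +>\<^bsub>free_algebra\<^esub> f. ?I +>\<^bsub>free_algebra\<^esub> (scalar c * g))"
    by (simp add: presented_algebra_def quotient_algebra_def ring.defs module.defs)
       (simp add: free_algebra_def)
  also have "\<dots> = (\<Union>g\<in>?I +>\<^bsub>free_algebra\<^esub> f. ?I +>\<^bsub>free_algebra\<^esub> (scalar c * f))"
    using eq by blast
  also have "\<dots> = ?I +>\<^bsub>free_algebra\<^esub> (scalar c * f)"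
    using I.a_rcos_self[of f] by auto
  finally show ?thesis .
qed

lemma ring_power_algebra: "ring (power_algebra :: ('k::field, 'k ^ 'n) module)"
  by (rule ringI, rule abelian_groupI)
     (auto simp: power_algebra_def algebra_simps intro!: monoidI intro: exI[of _ "- x" for x])

lemma matrix_add_rdistrib:
  fixes A B :: "'a::semiring_1 ^ 'm ^ 'n"
  shows "(A + B) ** C = A ** C + B ** C"
  by (simp add: matrix_matrix_mult_def Finite_Cartesian_Product.vec_eq_iff distrib_right sum.distrib)

lemma ring_matrix_algebra: "ring (matrix_algebra :: ('k::field, 'k ^ 'n ^ 'n) module)"
proof (rule ringI)
  show "abelian_group (matrix_algebra :: ('k, 'k ^ 'n ^ 'n) module)"
    by (rule abelian_groupI)
      (auto simp: matrix_algebra_def add.assoc add.commute add.left_commute intro: exI[of _ "- x" for x])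
  show "Group.monoid (matrix_algebra :: ('k, 'k ^ 'n ^ 'n) module)"
    by (rule monoidI) (simp_all add: matrix_algebra_def matrix_mul_assoc)
qed (simp_all add: matrix_algebra_def matrix_add_ldistrib matrix_add_rdistrib)

section \<open>Evaluation of words, matrix units and the nine characters\<close>

definition monoid_eval :: "('b \<Rightarrow> 'b \<Rightarrow> 'b) \<Rightarrow> 'b \<Rightarrow> ('g \<Rightarrow> 'b) \<Rightarrow> 'g free_monoid \<Rightarrow> 'b"
  where "monoid_eval mul e r w = foldr (\<lambda>g. mul (r g)) (letters w) e"

lemma monoid_eval_0: "monoid_eval mul e r 0 = e"
  by (simp add: monoid_eval_def zero_free_monoid_def)

lemma monoid_eval_gen: "(\<And>a. mul a e = a) \<Longrightarrow> monoid_eval mul e r (Word [g]) = r g"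
  by (simp add: monoid_eval_def)

lemma monoid_eval_plus:
  assumes "\<And>a b c. mul (mul a b) c = mul a (mul b c)" "\<And>a. mul e a = a"
  shows "monoid_eval mul e r (u + v) = mul (monoid_eval mul e r u) (monoid_eval mul e r v)"
proof -
  have "foldr (\<lambda>g. mul (r g)) gs (mul e b) = mul (foldr (\<lambda>g. mul (r g)) gs e) b" for gs b
    by (induction gs) (simp_all add: assms)
  from this[of "letters u" "monoid_eval mul e r v"] show ?thesis
    by (simp add: monoid_eval_def plus_free_monoid_def assms(2))
qed

definition matrix_unit :: "'n \<Rightarrow> 'n \<Rightarrow> 'k::field ^ 'n ^ 'n"
  where "matrix_unit a b = (\<chi> i j. if i = a \<and> j = b then 1 else 0)"

lemma matrix_unit_mult_left: "(matrix_unit a b ** M) $ i $ j = (if i = a then M $ b $ j else 0)"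
  by (simp add: matrix_unit_def matrix_matrix_mult_def if_distrib[of "\<lambda>c. c * _"] if_conn sum.delta' cong: if_cong)

lemma matrix_unit_mult_right: "(M ** matrix_unit a b) $ i $ j = (if j = b then M $ i $ a else 0)"
  by (simp add: matrix_unit_def matrix_matrix_mult_def if_distrib[of "\<lambda>c. _ * c"] if_conn sum.delta cong: if_cong)

definition idem_index :: "2 \<Rightarrow> 3"
  where "idem_index i = (if i = 1 then 1 else 2)"

text \<open>Any bijection will do: it labels the nine coordinates by the pairs (a, j) that index the
  characters.\<close>

definition char_index :: "9 \<Rightarrow> 3 \<times> 3"
  where "char_index = (SOME f. bij f)"

lemma bij_char_index: "bij char_index"
proof -
  have "\<exists>f. bij_betw f (UNIV :: 9 set) (UNIV :: (3 \<times> 3) set)"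
    by (rule finite_same_card_bij) simp_all
  then show ?thesis unfolding char_index_def by (rule someI_ex)
qed

definition char_vec :: "(3 \<Rightarrow> 3 \<Rightarrow> 'k::field) \<Rightarrow> 'k ^ 9"
  where "char_vec c = (\<chi> w. c (fst (char_index w)) (snd (char_index w)))"

lemma char_vec_simps:
  "char_vec c + char_vec d = char_vec (\<lambda>a j. c a j + d a j)"
  "char_vec c - char_vec d = char_vec (\<lambda>a j. c a j - d a j)"
  "char_vec c * char_vec d = char_vec (\<lambda>a j. c a j * d a j)"
  "k *s char_vec c = char_vec (\<lambda>a j. k * c a j)"
  "1 - char_vec c = char_vec (\<lambda>a j. 1 - c a j)" "char_vec (\<lambda>a j. 0) = 0"
  by (simp_all add: char_vec_def Finite_Cartesian_Product.vec_eq_iff)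

text \<open>All nine characters at once. Those with \<open>j = 3\<close> send both \<open>Q\<close>
  generators to 0, those with \<open>a = 3\<close> both \<open>P\<close> generators.\<close>

primrec char_gen :: "S_gen \<Rightarrow> 'k::field ^ 9" where
  "char_gen (P i) = char_vec (\<lambda>a j. if a = idem_index i then 1 else 0)"
| "char_gen (Q i) = char_vec (\<lambda>a j. if j = idem_index i then 1 else 0)"

lemma linear_extension_char:
  "linear_extension (*s) (*) (monoid_eval (*) 1 (char_gen :: _ \<Rightarrow> 'k::field ^ 9))"
  by standard
    (simp_all add: monoid_eval_plus mult.assoc Finite_Cartesian_Product.vec_eq_iff algebra_simps)

lemma linear_extension_matrix:
  "linear_extension (\<lambda>c A. \<chi> i j. c * A $ i $ j) (**) (monoid_eval (**) (Finite_Cartesian_Product.mat 1) (r :: _ \<Rightarrow> 'k::field ^ 'n ^ 'n))"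
  by standard
    (simp_all add: monoid_eval_plus matrix_mul_assoc matrix_add_ldistrib matrix_add_rdistrib Finite_Cartesian_Product.vec_eq_iff
      algebra_simps, simp add: matrix_matrix_mult_def sum_distrib_left algebra_simps)

text \<open>On a matrix type \<open>*s\<close> would expect a vector as scalar, hence a separate
  operation.\<close>

definition msc :: "'k::field \<Rightarrow> 'k ^ 'n ^ 'm \<Rightarrow> 'k ^ 'n ^ 'm"
  where "msc c A = (\<chi> i j. c * A $ i $ j)"

lemma msc_nth [simp]: "msc c A $ i $ j = c * A $ i $ j"
  by (simp add: msc_def)

lemma msc_mult_left: "msc c A ** B = msc c (A ** B)"
  by (simp add: matrix_matrix_mult_def Finite_Cartesian_Product.vec_eq_iff sum_distrib_left mult.assoc)

lemma msc_msc: "msc c (msc d A) = msc (c * d) A"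
  by (simp add: Finite_Cartesian_Product.vec_eq_iff)

lemma matrix_unit_nth: "matrix_unit a b $ i $ j = (if i = a \<and> j = b then 1 else 0)"
  by (simp add: matrix_unit_def)

lemma matrix_unit_sandwich: "matrix_unit a b ** M ** matrix_unit c d = msc (M $ b $ c) (matrix_unit a d)"
  by (simp add: Finite_Cartesian_Product.vec_eq_iff matrix_unit_mult_left matrix_unit_mult_right matrix_unit_nth)

lemma direct_sum_simps:
  fixes A :: "('k::field, 'a) module" and B :: "('k, 'b) module"
  shows "carrier (algebra_direct_sum A B) = carrier A \<times> carrier B"
    "\<one>\<^bsub>algebra_direct_sum A B\<^esub> = (\<one>\<^bsub>A\<^esub>, \<one>\<^bsub>B\<^esub>)"
    "\<zero>\<^bsub>algebra_direct_sum A B\<^esub> = (\<zero>\<^bsub>A\<^esub>, \<zero>\<^bsub>B\<^esub>)"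
    "(a, b) \<otimes>\<^bsub>algebra_direct_sum A B\<^esub> (a', b') = (a \<otimes>\<^bsub>A\<^esub> a', b \<otimes>\<^bsub>B\<^esub> b')"
    "(a, b) \<oplus>\<^bsub>algebra_direct_sum A B\<^esub> (a', b') = (a \<oplus>\<^bsub>A\<^esub> a', b \<oplus>\<^bsub>B\<^esub> b')"
    "c \<odot>\<^bsub>algebra_direct_sum A B\<^esub> (a, b) = (c \<odot>\<^bsub>A\<^esub> a, c \<odot>\<^bsub>B\<^esub> b)"
  by (simp_all add: algebra_direct_sum_def RDirProd_def DirProd_def ring.defs monoid.defs module.defs)

section \<open>The representation and its kernel\<close>

context generic_point
begin

abbreviation (input) s where "s \<equiv> opposite_slope x"

definition T_entry :: "3 \<Rightarrow> 3 \<Rightarrow> 'k"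
  where "T_entry a b = s 1 * s 2 * s 3 * n b / (s a * s b)"

lemma s_prod: "distinct [a, b, c] \<Longrightarrow> s 1 * s 2 * s 3 = s a * s b * s c"
  using exhaust_3[of a] exhaust_3[of b] exhaust_3[of c] by auto

lemma T_entry_off_diagonal: "distinct [a, b, c] \<Longrightarrow> T_entry a b = s c * n b"
  using s_prod[of a b c] s_nonzero by (simp add: T_entry_def)

definition T_matrix :: "'k ^ 3 ^ 3" where "T_matrix = (\<chi> a b. T_entry a b)"
definition Y_matrix :: "'k ^ 3 ^ 3" where "Y_matrix = (\<chi> a b. n b)"

lemma n_sums:
  "(\<Sum>a\<in>UNIV. n a) = 1" "(\<Sum>a\<in>UNIV. n a / s a) = 0"
  "(\<Sum>a\<in>UNIV. n a / (s a)^2) = 1 / (s 1 * s 2 * s 3)"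
  unfolding sum_3 by (rule n_sum n_s_sum n_ss_sum, simp)+

text \<open>Each matrix is a column times a row: ones and \<open>n b\<close> for
  \<open>Y_matrix\<close>, \<open>s 1 * s 2 * s 3 / s a\<close> and \<open>n b / s b\<close> for
  \<open>T_matrix\<close>. The row-column products are Lagrange's sums in
  \<open>n_sums\<close>.\<close>

lemma T_Y_mult:
  "T_matrix ** T_matrix = T_matrix" "Y_matrix ** Y_matrix = Y_matrix"
  "T_matrix ** Y_matrix = 0" "Y_matrix ** T_matrix = 0"
proof -
  let ?l = "s 1 * s 2 * s 3"
  have l: "?l \<noteq> 0" using s_nonzero by simp
  have "(\<Sum>b\<in>UNIV. T_entry a b * T_entry b c) = (?l^2 * n c / (s a * s c)) * (\<Sum>b\<in>UNIV. n b / (s b)^2)" for a c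
    unfolding sum_distrib_left T_entry_def by (rule sum.cong) (simp_all add: power2_eq_square mult_ac)
  then have "(\<Sum>b\<in>UNIV. T_entry a b * T_entry b c) = T_entry a c" for a c
    unfolding n_sums using l by (simp add: T_entry_def power2_eq_square)
  then show "T_matrix ** T_matrix = T_matrix"
    by (simp add: T_matrix_def matrix_matrix_mult_def Finite_Cartesian_Product.vec_eq_iff)
  show "Y_matrix ** Y_matrix = Y_matrix"
    by (simp add: Y_matrix_def matrix_matrix_mult_def Finite_Cartesian_Product.vec_eq_iff n_sums flip: sum_distrib_right)
  have "(\<Sum>b\<in>UNIV. T_entry a b * n c) = (?l * n c / s a) * (\<Sum>b\<in>UNIV. n b / s b)" for a c
    unfolding sum_distrib_left T_entry_def by (rule sum.cong) (simp_all add: mult_ac)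
  then show "T_matrix ** Y_matrix = 0"
    by (simp add: T_matrix_def Y_matrix_def matrix_matrix_mult_def Finite_Cartesian_Product.vec_eq_iff n_sums)
  have "(\<Sum>b\<in>UNIV. n b * T_entry b c) = (?l * n c / s c) * (\<Sum>b\<in>UNIV. n b / s b)" for c
    unfolding sum_distrib_left T_entry_def by (rule sum.cong) (simp_all add: mult_ac)
  then show "Y_matrix ** T_matrix = 0"
    by (simp add: T_matrix_def Y_matrix_def matrix_matrix_mult_def Finite_Cartesian_Product.vec_eq_iff n_sums)
qed

primrec matrix_gen :: "S_gen \<Rightarrow> 'k ^ 3 ^ 3" where
  "matrix_gen (P i) = matrix_unit (idem_index i) (idem_index i)"
| "matrix_gen (Q i) = (if i = 1 then T_matrix else Y_matrix)"

sublocale R1: linear_extension "(*s)" "(*)" "monoid_eval (*) 1 (char_gen :: S_gen \<Rightarrow> 'k ^ 9)"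
  by (rule linear_extension_char)

sublocale R2: linear_extension "\<lambda>c A. \<chi> i j. c * A $ i $ j" "(**)"
    "monoid_eval (**) (Finite_Cartesian_Product.mat 1) matrix_gen"
  by (rule linear_extension_matrix)

lemma R1_gen: "R1.ext (gen g) = char_gen g"
  by (simp add: gen_def monoid_eval_gen)

lemma R1_scalar: "R1.ext (scalar c) = c *s 1"
  by (simp add: scalar_def monoid_eval_0)

lemma R1_1: "R1.ext 1 = 1"
  using R1_scalar[of 1] by (simp add: scalar_simps)

lemma R1_scale: "R1.ext (scalar c * f) = c *s R1.ext f"
  by (simp add: R1.ext_mult R1_scalar Finite_Cartesian_Product.vec_eq_iff)

lemma R2_gen: "R2.ext (gen g) = matrix_gen g"
  by (simp add: gen_def monoid_eval_gen)

lemma R2_scalar: "R2.ext (scalar c) = msc c (Finite_Cartesian_Product.mat 1)"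
  by (simp add: scalar_def monoid_eval_0 msc_def)

lemma R2_1: "R2.ext 1 = Finite_Cartesian_Product.mat 1"
  using R2_scalar[of 1] by (simp add: scalar_simps msc_def)

lemma R2_scale: "R2.ext (scalar c * f) = msc c (R2.ext f)"
  by (simp add: R2.ext_mult R2_scalar msc_mult_left)

lemma R1_idem_P: "R1.ext (idem_P a) = char_vec (\<lambda>a' j. if a' = a then 1 else 0)"
proof -
  have "char_vec (\<lambda>a' j. 1 - (if a' = 1 then 1 else 0) - (if a' = 2 then 1 else 0))
    = (char_vec (\<lambda>a' j. if a' = 3 then 1 else 0) :: 'k ^ 9)"
    by (rule arg_cong[of _ _ char_vec], intro ext) (use exhaust_3 in auto)
  then show ?thesis
    using exhaust_3[of a]
    by (auto simp: idem_P_def R1.ext_diff R1_gen R1_1 idem_index_def char_vec_simps)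
qed

lemma R2_idem_P: "R2.ext (idem_P a) = matrix_unit a a"
proof -
  have "Finite_Cartesian_Product.mat 1 - matrix_unit 1 1 - matrix_unit 2 2 = (matrix_unit 3 3 :: 'k ^ 3 ^ 3)"
    by (simp add: Finite_Cartesian_Product.vec_eq_iff matrix_unit_nth Finite_Cartesian_Product.mat_def forall_3)
  then show ?thesis
    using exhaust_3[of a] by (auto simp: idem_P_def R2.ext_diff R2_gen R2_1 idem_index_def)
qed

lemma relations_R1: "r \<in> S_relations x \<Longrightarrow> R1.ext r = 0"
proof -
  have inj: "idem_index i = idem_index j \<longleftrightarrow> i = j" for i j
    using exhaust_2[of i] exhaust_2[of j] by (auto simp: idem_index_def)
  assume "r \<in> S_relations x"
  then show ?thesis
    unfolding S_relations_def
    by (auto simp: R1.ext_diff R1.ext_mult R1.ext_sum R1_gen R1_scalar char_vec_def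
        Finite_Cartesian_Product.vec_eq_iff inj)
qed

text \<open>Off the diagonal this is the definition of the slope, since \<open>T_entry a b\<close>
  is \<open>s c\<close> times \<open>n b\<close>; on the diagonal the coefficients vanish.\<close>

lemma T_Y_relation:
  "(\<Sum>j\<in>UNIV. (coord x a j - coord x b j) * (if j = 1 then T_matrix else Y_matrix) $ a $ b) = 0"
proof (cases "a = b")
  case False
  then obtain c where c: "distinct [a, b, c]" by (rule ex_distinct_3)
  show ?thesis
    using coord_neq[OF False, of 1] T_entry_off_diagonal[OF c]
    by (simp add: sum_2 T_matrix_def Y_matrix_def opposite_slope_eq[OF c] slope_def)
      (simp add: algebra_simps)
qed simp

lemma relations_R2: "r \<in> S_relations x \<Longrightarrow> R2.ext r = 0"
proof -
  have inj: "idem_index i = idem_index j \<longleftrightarrow> i = j" for i j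
    using exhaust_2[of i] exhaust_2[of j] by (auto simp: idem_index_def)
  have coord: "(\<Sum>i\<in>UNIV. if a = idem_index i then x $ (i, j) else 0) = coord x a j" for a j
    using exhaust_3[of a] by (auto simp: sum_2 idem_index_def coord_def)
  \<comment> \<open>The (a, b) entry of a commutator with \<open>matrix_unit i i\<close> picks up +1
    for row \<open>a\<close> and -1 for column \<open>b\<close>. Summing over \<open>i\<close>
    produces the coordinate differences of \<open>T_Y_relation\<close>.\<close>
  have "R2.ext (\<Sum>i\<in>UNIV. \<Sum>j\<in>UNIV. scalar (x $ (i, j)) * (gen (P i) * gen (Q j) - gen (Q j) * gen (P i))) $ a $ b
    = (\<Sum>j\<in>UNIV. \<Sum>i\<in>UNIV. ((if a = idem_index i then x $ (i, j) else 0) - (if b = idem_index i then x $ (i, j) else 0))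
        * (if j = 1 then T_matrix else Y_matrix) $ a $ b)" for a b
    unfolding R2.ext_sum R2_scale
    unfolding R2.ext_diff R2.ext_mult R2_gen
    by (subst sum.swap)
       (auto simp: matrix_unit_mult_left matrix_unit_mult_right algebra_simps intro!: sum.cong)
  then have "R2.ext (\<Sum>i\<in>UNIV. \<Sum>j\<in>UNIV. scalar (x $ (i, j)) * (gen (P i) * gen (Q j) - gen (Q j) * gen (P i))) = 0"
    using T_Y_relation
    by (simp add: Finite_Cartesian_Product.vec_eq_iff sum_distrib_right[symmetric] sum_subtractf coord)
  moreover have "R2.ext (gen (P i) * gen (P j) - (if i = j then gen (P i) else 0)) = 0" for i j
    by (auto simp: R2.ext_diff R2.ext_mult R2_gen Finite_Cartesian_Product.vec_eq_iff matrix_unit_mult_left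
        matrix_unit_nth inj)
  moreover have "R2.ext (gen (Q i) * gen (Q j) - (if i = j then gen (Q i) else 0)) = 0" for i j
    using exhaust_2[of i] exhaust_2[of j] T_Y_mult
    by (auto simp: R2.ext_diff R2.ext_mult R2_gen)
  moreover assume "r \<in> S_relations x"
  ultimately show ?thesis
    unfolding S_relations_def by blast
qed

definition rep :: "('k, S_gen) free_alg \<Rightarrow> ('k ^ 9) \<times> ('k ^ 3 ^ 3)"
  where "rep f = (R1.ext f, R2.ext f)"

abbreviation "target \<equiv> algebra_direct_sum (power_algebra :: ('k, 'k ^ 9) module) (matrix_algebra :: ('k, 'k ^ 3 ^ 3) module)"

lemma ring_target: "ring target"
  unfolding algebra_direct_sum_def
  by (intro ring_extend_ring RDirProd_ring ring_power_algebra ring_matrix_algebra)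

lemmas target_simps = direct_sum_simps power_algebra_def matrix_algebra_def

sublocale rep: ring_hom_ring free_algebra target rep
proof (rule ring_hom_ringI2[OF ring_free_algebra ring_target], rule ring_hom_memI)
qed (auto simp: target_simps free_algebra_def rep_def R1.ext_add R2.ext_add R1.ext_mult R2.ext_mult R1_1 R2_1)

text \<open>The kernel of \<open>rep\<close> is an ideal containing the relations, hence contains
  the ideal they generate. The converse, in \<open>relation_ideal_eq\<close>, rests on the spanning
  result.\<close>

lemma rep_eq_0: "f \<in> relation_ideal \<Longrightarrow> R1.ext f = 0 \<and> R2.ext f = 0"
proof -
  have "S_relations x \<subseteq> a_kernel free_algebra target rep"
    by (auto simp: a_kernel_def' rep_def relations_R1 relations_R2 target_simps)
  from ring.genideal_minimal[OF ring_free_algebra rep.kernel_is_ideal this]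
  show "f \<in> relation_ideal \<Longrightarrow> R1.ext f = 0 \<and> R2.ext f = 0"
    by (auto simp: a_kernel_def' rep_def target_simps)
qed

abbreviation (input) Y :: "('k, S_gen) free_alg" where "Y \<equiv> gen (Q 2)"
abbreviation (input) T :: "('k, S_gen) free_alg" where "T \<equiv> gen (Q 1)"

lemma rep_blocks:
  "R1.ext (idem_P a * T * idem_P a) = char_vec (\<lambda>a' j. if a' = a \<and> j = 1 then 1 else 0)"
  "R2.ext (idem_P a * T * idem_P a) = msc (T_entry a a) (matrix_unit a a)"
  "R1.ext (idem_P a * Y * idem_P b) = char_vec (\<lambda>a' j. if a' = a \<and> a = b \<and> j = 2 then 1 else 0)"
  "R2.ext (idem_P a * Y * idem_P b) = msc (n b) (matrix_unit a b)"
  "a \<noteq> b \<Longrightarrow> R1.ext (idem_P a * Y * idem_P b * Y * idem_P a) = 0"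
  "R2.ext (idem_P a * Y * idem_P b * Y * idem_P a) = msc (n b * n a) (matrix_unit a a)"
proof -
  show "R1.ext (idem_P a * T * idem_P a) = char_vec (\<lambda>a' j. if a' = a \<and> j = 1 then 1 else 0)"
    "R1.ext (idem_P a * Y * idem_P b) = char_vec (\<lambda>a' j. if a' = a \<and> a = b \<and> j = 2 then 1 else 0)"
    by (auto simp: R1.ext_mult R1_idem_P R1_gen char_vec_simps(3) idem_index_def intro!: arg_cong[of _ _ char_vec])
  show "R1.ext (idem_P a * Y * idem_P b * Y * idem_P a) = 0" if "a \<noteq> b"
    unfolding char_vec_simps(6)[symmetric]
    using that by (auto simp: R1.ext_mult R1_idem_P R1_gen char_vec_simps(3) intro!: arg_cong[of _ _ char_vec])
qed (simp_all add: R2.ext_mult R2_idem_P R2_gen matrix_unit_sandwich msc_mult_left msc_msc T_matrix_def Y_matrix_def)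

text \<open>Lifts of the matrix units and of the idempotents of \<open>k\<^sup>9\<close> to the free algebra. Addition in the
  index type \<open>3\<close> is cyclic, so \<open>a + 1 \<noteq> a\<close>; the third index of the characters stands for \<open>q\<^sub>3\<close>.\<close>

definition unit_lift :: "3 \<Rightarrow> 3 \<Rightarrow> ('k, S_gen) free_alg"
  where "unit_lift a b = (if a = b
    then scalar (1 / (n (a + 1) * n a)) * (idem_P a * Y * idem_P (a + 1) * Y * idem_P a)
    else scalar (1 / n b) * (idem_P a * Y * idem_P b))"

definition char_lift :: "3 \<Rightarrow> 3 \<Rightarrow> ('k, S_gen) free_alg"
  where "char_lift a j =
    (let t = idem_P a * T * idem_P a - scalar (T_entry a a) * unit_lift a a;
         y = idem_P a * Y * idem_P a - scalar (n a) * unit_lift a a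
     in if j = 1 then t else if j = 2 then y else idem_P a - unit_lift a a - t - y)"

lemma rep_unit_lift: "R1.ext (unit_lift a b) = 0" "R2.ext (unit_lift a b) = matrix_unit a b"
  using n_nonzero
  by (auto simp: unit_lift_def R1_scale R2_scale rep_blocks char_vec_simps msc_msc)
     (simp_all add: msc_def)

lemma rep_char_lift:
  "R1.ext (char_lift a j) = char_vec (\<lambda>a' j'. if a' = a \<and> j' = j then 1 else 0)"
  "R2.ext (char_lift a j) = 0"
proof -
  have "(\<lambda>a' j'. (if a' = a then 1 else 0) - (if a' = a \<and> j' = 1 then 1 else 0)
      - (if a' = a \<and> j' = 2 then 1 else 0)) = (\<lambda>a' (j' :: 3). if a' = a \<and> j' = 3 then 1 else 0 :: 'k)"
    by (intro ext) (use exhaust_3 in auto)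
  then show "R1.ext (char_lift a j) = char_vec (\<lambda>a' j'. if a' = a \<and> j' = j then 1 else 0)"
    using exhaust_3[of j]
    by (auto simp: char_lift_def Let_def R1.ext_diff R1_scale rep_blocks rep_unit_lift R1_idem_P
        char_vec_simps)
  show "R2.ext (char_lift a j) = 0"
    by (simp add: char_lift_def Let_def R2.ext_diff R2_scale rep_blocks rep_unit_lift R2_idem_P)
qed

text \<open>A linear right inverse of \<open>rep\<close>. It yields surjectivity and, once shown to
  be a two-sided inverse modulo the relations, the kernel.\<close>

definition section_rep :: "'k ^ 9 \<Rightarrow> 'k ^ 3 ^ 3 \<Rightarrow> ('k, S_gen) free_alg"
  where "section_rep v M = (\<Sum>a\<in>UNIV. \<Sum>b\<in>UNIV. scalar (M $ a $ b) * unit_lift a b)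
    + (\<Sum>w\<in>UNIV. scalar (v $ w) * char_lift (fst (char_index w)) (snd (char_index w)))"

lemma rep_section: "R1.ext (section_rep v M) = v" "R2.ext (section_rep v M) = M"
proof -
  have [simp]: "fst (char_index w) = fst (char_index w') \<and> snd (char_index w) = snd (char_index w')
    \<longleftrightarrow> w = w'" for w w'
    using bij_char_index by (auto simp: bij_def inj_def prod_eq_iff)
  have "(\<Sum>w\<in>UNIV. v $ w * (if w' = w then 1 else 0)) = v $ w'" for w'
    by (simp add: if_distrib[of "\<lambda>c. _ * c"] sum.delta cong: if_cong)
  then show "R1.ext (section_rep v M) = v"
    by (simp add: section_rep_def R1.ext_add R1.ext_sum R1_scale rep_unit_lift rep_char_lift
        Finite_Cartesian_Product.vec_eq_iff char_vec_def)
  have "(\<Sum>a\<in>UNIV. \<Sum>b\<in>UNIV. M $ a $ b * (if i = a \<and> j = b then 1 else 0)) = M $ i $ j" for i j :: 3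
  proof -
    have "(\<Sum>a\<in>UNIV. \<Sum>b\<in>UNIV. M $ a $ b * (if i = a \<and> j = b then 1 else 0))
      = (\<Sum>a\<in>UNIV. if i = a then M $ a $ j else 0)"
      by (intro sum.cong refl) (simp add: if_distrib[of "\<lambda>c. _ * c"] sum.delta cong: if_cong)
    then show ?thesis by simp
  qed
  then show "R2.ext (section_rep v M) = M"
    by (simp add: section_rep_def R2.ext_add R2.ext_sum R2_scale rep_unit_lift rep_char_lift
        Finite_Cartesian_Product.vec_eq_iff matrix_unit_nth)
qed

lemma section_add: "section_rep (v + v') (M + M') = section_rep v M + section_rep v' M'"
  by (simp add: section_rep_def scalar_simps distrib_right sum.distrib)

lemma section_scale: "section_rep (c *s v) (msc c M) = scalar c * section_rep v M"
  unfolding section_rep_def distrib_left sum_distrib_left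
  by (simp only: msc_nth vector_smult_component F.scale_scale[symmetric])

lemma section_0: "section_rep 0 0 = 0"
  by (simp add: section_rep_def)

lemma section_msc_unit: "section_rep 0 (msc c (matrix_unit a b)) = scalar c * unit_lift a b"
proof -
  have "(\<Sum>a'\<in>UNIV. \<Sum>b'\<in>UNIV. scalar (msc c (matrix_unit a b) $ a' $ b') * unit_lift a' b')
    = (\<Sum>a'\<in>UNIV. if a' = a then scalar c * unit_lift a' b else 0)"
    by (intro sum.cong refl)
       (simp add: matrix_unit_nth if_distrib[of "\<lambda>c. _ * c"] if_distrib[of scalar]
         if_distrib[of "\<lambda>c. c * _"] sum.delta cong: if_cong)
  then show ?thesis by (simp add: section_rep_def)
qed

lemma section_char: "section_rep (char_vec c) M = section_rep 0 M
    + (\<Sum>a\<in>UNIV. \<Sum>j\<in>UNIV. scalar (c a j) * char_lift a j)"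
proof -
  have "(\<Sum>w\<in>UNIV. scalar (c (fst (char_index w)) (snd (char_index w)))
      * char_lift (fst (char_index w)) (snd (char_index w)))
    = (\<Sum>z\<in>UNIV. scalar (c (fst z) (snd z)) * char_lift (fst z) (snd z))"
    by (rule sum.reindex_bij_betw) (rule bij_char_index)
  also have "\<dots> = (\<Sum>a\<in>UNIV. \<Sum>j\<in>UNIV. scalar (c a j) * char_lift a j)"
    by (simp add: sum.cartesian_product split_def)
  finally show ?thesis by (simp add: section_rep_def char_vec_def)
qed

lemma section_char_unit:
  "section_rep (char_vec (\<lambda>a' j'. if a' = a \<and> j' = j then 1 else 0)) M = section_rep 0 M + char_lift a j"
  unfolding section_char sum_3 using exhaust_3[of a] exhaust_3[of j] by (auto simp: scalar_simps)

lemma section_char_row: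
  "section_rep (char_vec (\<lambda>a' j'. if a' = a then 1 else 0)) M
    = section_rep 0 M + (char_lift a 1 + char_lift a 2 + char_lift a 3)"
  unfolding section_char sum_3 using exhaust_3[of a] by (auto simp: scalar_simps)

text \<open>The congruence is linear in \<open>f\<close>, so it suffices to check it on the ideal,
  where \<open>rep\<close> vanishes, and on the blocks; together these span everything.\<close>

lemma section_inverse: "F.cong f (section_rep (R1.ext f) (R2.ext f))"
proof -
  define W where "W = {f. F.cong f (section_rep (R1.ext f) (R2.ext f))}"
  have "F.subspace W"
    unfolding F.subspace_def W_def
    by (auto simp: R1.ext_add R2.ext_add section_add R1_scale R2_scale section_scale section_0
        intro: F.cong_add F.cong_scale)
  moreover have "relation_ideal \<subseteq> W"
    using rep_eq_0 by (auto simp: W_def F.cong_def section_0)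
  moreover have "blocks \<subseteq> W"
  proof -
    \<comment> \<open>The three character lifts of row \<open>a\<close> telescope to
      \<open>idem_P a - unit_lift a a\<close>, and the matrix part restores
      \<open>unit_lift a a\<close>.\<close>
    have 1: "section_rep (R1.ext (idem_P a)) (R2.ext (idem_P a)) = idem_P a" for a
      using section_msc_unit[of 1 a a]
      by (simp add: R1_idem_P R2_idem_P section_char_row char_lift_def Let_def msc_def scalar_simps)
    have 2: "section_rep (R1.ext (idem_P a * T * idem_P a)) (R2.ext (idem_P a * T * idem_P a))
      = idem_P a * T * idem_P a" for a
      by (simp add: rep_blocks section_char_unit section_msc_unit char_lift_def Let_def)
    have 3: "section_rep (R1.ext (idem_P a * Y * idem_P b)) (R2.ext (idem_P a * Y * idem_P b))
      = idem_P a * Y * idem_P b" for a b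
    proof (cases "a = b")
      case True
      then show ?thesis
        by (simp add: rep_blocks section_char_unit section_msc_unit char_lift_def Let_def)
    next
      case False
      then have "char_vec (\<lambda>a' j. if a' = a \<and> a = b \<and> j = 2 then 1 else 0) = (0 :: 'k ^ 9)"
        by (simp add: char_vec_simps(6))
      then have "section_rep (R1.ext (idem_P a * Y * idem_P b)) (R2.ext (idem_P a * Y * idem_P b))
        = scalar (n b) * unit_lift a b"
        by (simp only: rep_blocks section_msc_unit)
      also have "\<dots> = idem_P a * Y * idem_P b"
        unfolding unit_lift_def if_not_P[OF False] F.scale_scale using n_nonzero by (simp add: scalar_simps)
      finally show ?thesis .
    qed
    \<comment> \<open>Among the blocks, only the returns are recovered merely modulo the ideal:
      \<open>unit_lift a a\<close> is built from the return through \<open>a + 1\<close>, and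
      \<open>y_return\<close> compares the one through \<open>b\<close> with it.\<close>
    have 4: "F.cong (idem_P a * Y * idem_P b * Y * idem_P a)
       (section_rep (R1.ext (idem_P a * Y * idem_P b * Y * idem_P a))
          (R2.ext (idem_P a * Y * idem_P b * Y * idem_P a)))" if "a \<noteq> b" for a b
    proof -
      have "F.cong (idem_P a * Y * idem_P b * Y * idem_P a)
        (scalar (n b / n (a + 1)) * (idem_P a * Y * idem_P (a + 1) * Y * idem_P a))"
        by (rule F.cong_divide[OF n_nonzero y_return[OF that]]) simp
      also have "scalar (n b / n (a + 1)) * (idem_P a * Y * idem_P (a + 1) * Y * idem_P a)
         = section_rep 0 (msc (n b * n a) (matrix_unit a a))"
        unfolding section_msc_unit unit_lift_def if_P[OF refl] F.scale_scale using n_nonzero by simp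
      finally show ?thesis using that by (simp add: rep_blocks)
    qed
    show ?thesis
      unfolding blocks_def W_def using 1 2 3 4 by auto
  qed
  ultimately have "V \<subseteq> W" by (rule V_minimal)
  then show ?thesis by (auto simp: V_eq_UNIV W_def)
qed

lemma relation_ideal_eq: "f \<in> relation_ideal \<longleftrightarrow> rep f = (0, 0)"
  using rep_eq_0[of f] section_inverse[of f] by (auto simp: rep_def F.cong_def section_0)

lemma a_kernel_rep: "a_kernel free_algebra target rep = relation_ideal"
proof (rule Set.set_eqI)
  fix f
  have "\<zero>\<^bsub>target\<^esub> = (0, 0)" by (simp add: target_simps)
  then have "f \<in> a_kernel free_algebra target rep \<longleftrightarrow> rep f = (0, 0)"
    by (simp only: a_kernel_def' mem_Collect_eq carrier_free_algebra UNIV_I simp_thms)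
  then show "f \<in> a_kernel free_algebra target rep \<longleftrightarrow> f \<in> relation_ideal"
    unfolding relation_ideal_eq .
qed

text \<open>The first isomorphism theorem for rings; compatibility with scalars is checked
  separately on representatives.\<close>

lemma S_algebra_iso: "(\<lambda>X. the_elem (rep ` X)) \<in> algebra_iso (S_algebra x) target"
proof -
  let ?h = "\<lambda>X. the_elem (rep ` X)"
  have "rep (section_rep v M) = (v, M)" for v M
    by (simp add: rep_def rep_section)
  then have "rep ` carrier free_algebra = carrier target"
    by (auto simp: target_simps) (metis rangeI)
  then have "?h \<in> ring_iso (free_algebra Quot relation_ideal) target"
    using rep.FactRing_iso_set by (simp add: a_kernel_rep)
  then have "?h \<in> ring_iso (S_algebra x) target"
    by (simp add: ring_iso_def Ring.ring_hom_def S_algebra_def presented_algebra_def quotient_algebra_def ring.defs)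
  moreover have "?h (c \<odot>\<^bsub>S_algebra x\<^esub> X) = c \<odot>\<^bsub>target\<^esub> ?h X" if X_in: "X \<in> carrier (S_algebra x)" for c X
  proof -
    obtain f where X: "X = relation_ideal +>\<^bsub>free_algebra\<^esub> f"
      using X_in by (auto simp: S_algebra_def presented_algebra_carrier)
    have "?h (relation_ideal +>\<^bsub>free_algebra\<^esub> g) = rep g" for g
      using rep.the_elem_simp[of g] by (simp add: a_kernel_rep)
    then show ?thesis
      by (simp add: X S_algebra_def presented_algebra_smult rep_def R1_scale R2_scale target_simps msc_def)
  qed
  ultimately show ?thesis by (simp add: algebra_iso_def)
qed

text \<open>\<open>section_rep\<close> followed by passage to cosets is a linear bijection from an
  18-dimensional coordinate space, which transports the dimension.\<close>

lemma S_algebra_dim: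
  "vectorspace.fin_dim class_ring (S_algebra x)" "vectorspace.dim class_ring (S_algebra x) = 18"
proof -
  let ?V = "module_vec TYPE('k) 18"
  \<comment> \<open>Enumerates the 9 + 9 coordinates of a vector in \<open>'k ^ 9\<close> and a 3 by
    3 matrix.\<close>
  have "\<exists>i. bij_betw i (UNIV :: (9 + 3 \<times> 3) set) {..<18 :: nat}"
    by (rule finite_same_card_bij) simp_all
  then obtain i :: "9 + 3 \<times> 3 \<Rightarrow> nat" where i: "bij_betw i UNIV {..<18}" by blast
  then have i_less: "i z < 18" for z by (auto simp: bij_betw_def)
  have i_surj: "\<exists>z. k = i z" if "k < 18" for k
    using i that by (auto simp: bij_betw_def image_iff set_eq_iff)
  define v where "v u = (\<chi> w. vec_index u (i (Inl w)))" for u :: "'k Matrix.vec"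
  define M where "M u = (\<chi> a b. vec_index u (i (Inr (a, b))))" for u :: "'k Matrix.vec"
  let ?T = "\<lambda>u. relation_ideal +>\<^bsub>free_algebra\<^esub> section_rep (v u) (M u)"
  have "module class_ring ?V" "module class_ring (S_algebra x)"
    using vec_vs vectorspace_presented_algebra by (auto simp: vectorspace_def S_algebra_def)
  moreover have "?T \<in> LinearCombinations.module_hom class_ring ?V (S_algebra x)"
  proof -
    have "section_rep (v (u + u')) (M (u + u')) = section_rep (v u) (M u) + section_rep (v u') (M u')"
      if "u \<in> carrier_vec 18" "u' \<in> carrier_vec 18" for u u'
    proof -
      have "v (u + u') = v u + v u'" "M (u + u') = M u + M u'"
        using that i_less by (auto simp: v_def M_def Finite_Cartesian_Product.vec_eq_iff)
      then show ?thesis by (simp add: section_add)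
    qed
    moreover have "section_rep (v (c \<cdot>\<^sub>v u)) (M (c \<cdot>\<^sub>v u)) = scalar c * section_rep (v u) (M u)"
      if "u \<in> carrier_vec 18" for c u
    proof -
      have "v (c \<cdot>\<^sub>v u) = c *s v u" "M (c \<cdot>\<^sub>v u) = msc c (M u)"
        using that i_less by (auto simp: v_def M_def Finite_Cartesian_Product.vec_eq_iff)
      then show ?thesis by (simp add: section_scale)
    qed
    ultimately show ?thesis
      by (auto simp: LinearCombinations.module_hom_def S_algebra_def presented_algebra_carrier
          presented_algebra_add presented_algebra_smult module_vec_simps)
  qed
  ultimately interpret lin: linear_map class_ring ?V "S_algebra x" ?T
    using vec_vs vectorspace_presented_algebra
    by (intro linear_map.intro mod_hom.intro mod_hom_axioms.intro) (simp_all add: S_algebra_def)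
  have "inj_on ?T (carrier ?V)"
  proof (rule inj_onI)
    fix u u' assume u: "u \<in> carrier ?V" "u' \<in> carrier ?V" and "?T u = ?T u'"
    then have "rep (section_rep (v u) (M u) - section_rep (v u') (M u')) = (0, 0)"
      by (simp add: coset_eq_iff flip: relation_ideal_eq)
    then have eq: "v u = v u'" "M u = M u'"
      by (simp_all add: rep_def R1.ext_diff R2.ext_diff rep_section)
    have "vec_index u (i z) = vec_index u' (i z)" for z
    proof (cases z)
      case (Inl w)
      then show ?thesis using arg_cong[OF eq(1), of "\<lambda>v. v $ w"] by (simp add: v_def)
    next
      case (Inr ab)
      then show ?thesis
        using arg_cong[OF eq(2), of "\<lambda>M. M $ fst ab $ snd ab"] by (simp add: M_def)
    qed
    then show "u = u'"
      using u i_surj by (intro Matrix.eq_vecI) (auto simp: module_vec_simps)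
  qed
  moreover have "?T ` carrier ?V = carrier (S_algebra x)"
  proof -
    have "relation_ideal +>\<^bsub>free_algebra\<^esub> f \<in> ?T ` carrier ?V" for f
    proof -
      define u where "u = Matrix.vec 18 (\<lambda>k. case inv_into UNIV i k of
        Inl w \<Rightarrow> R1.ext f $ w | Inr (a, b) \<Rightarrow> R2.ext f $ a $ b)"
      have "inv_into UNIV i (i z) = z" for z
        using i by (simp add: bij_betw_def)
      then have "v u = R1.ext f" "M u = R2.ext f"
        using i_less by (simp_all add: u_def v_def M_def Finite_Cartesian_Product.vec_eq_iff)
      then have "relation_ideal +>\<^bsub>free_algebra\<^esub> f = ?T u"
        using section_inverse[of f] by (simp add: coset_eq_iff F.cong_def)
      then show ?thesis by (auto simp: u_def module_vec_simps)
    qed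
    then show ?thesis by (auto simp: S_algebra_def presented_algebra_carrier)
  qed
  moreover have "vectorspace.fin_dim class_ring ?V"
    by (rule vec_space.fin_dim)
  ultimately show "vectorspace.fin_dim class_ring (S_algebra x)" "vectorspace.dim class_ring (S_algebra x) = 18"
    using lin.surj_fin_dim lin.dim_eq vec_space.dim_is_n[where ?'a = 'k and n = 18] by simp_all
qed

end

section \<open>The genericity form and its nonvanishing set\<close>

definition genericity :: "'k::field ^ (2 \<times> 2) \<Rightarrow> 'k"
  where "genericity x =
    x $ (1, 1) * x $ (1, 2) * x $ (2, 1) * x $ (2, 2)
    * (x $ (1, 1) - x $ (2, 1)) * (x $ (1, 2) - x $ (2, 2))
    * (x $ (1, 1) - x $ (1, 2)) * (x $ (2, 1) - x $ (2, 2))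
    * ((x $ (1, 1) - x $ (2, 1)) - (x $ (1, 2) - x $ (2, 2)))
    * (x $ (1, 1) * x $ (2, 2) - x $ (1, 2) * x $ (2, 1))"

lemma is_form_genericity: "is_form 11 (genericity :: 'k::field ^ (2 \<times> 2) \<Rightarrow> 'k)"
proof -
  \<comment> \<open>Nine linear factors and one quadratic factor.\<close>
  have "is_form (1 + 1 + 1 + 1 + 1 + 1 + 1 + 1 + 1 + (1 + 1)) (genericity :: 'k::field ^ (2 \<times> 2) \<Rightarrow> 'k)"
    unfolding genericity_def by (intro is_form_mult is_form_diff is_form_coordinate)
  then show ?thesis by (simp add: numeral_eq_Suc)
qed

text \<open>Entries and differences within a column give \<open>coord_neq\<close>; differences
  within a row and the mixed difference give \<open>coord_diff_neq\<close>; the last factor is the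
  determinant. Single entries and row differences come from comparison with the zero row 3.\<close>

lemma generic_point_if_genericity:
  fixes x :: "'k::field_char_0 ^ (2 \<times> 2)"
  assumes "genericity x \<noteq> 0"
  shows "generic_point x"
proof
  have nz: "x $ (1, 1) \<noteq> 0" "x $ (1, 2) \<noteq> 0" "x $ (2, 1) \<noteq> 0" "x $ (2, 2) \<noteq> 0"
    "x $ (1, 1) \<noteq> x $ (2, 1)" "x $ (1, 2) \<noteq> x $ (2, 2)" "x $ (1, 1) \<noteq> x $ (1, 2)" "x $ (2, 1) \<noteq> x $ (2, 2)"
    "x $ (1, 1) - x $ (2, 1) \<noteq> x $ (1, 2) - x $ (2, 2)"
    using assms unfolding genericity_def mult_eq_0_iff by (simp_all only: de_Morgan_disj) simp_all
  fix a b :: 3 and j :: 2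
  assume "a \<noteq> b"
  then show "coord x a j \<noteq> coord x b j"
    using nz exhaust_3[of a] exhaust_3[of b] exhaust_2[of j] by (auto simp: coord_def)
  have "x $ (2, 1) - x $ (1, 1) \<noteq> x $ (2, 2) - x $ (1, 2)"
    using nz(9) by (metis minus_diff_eq)
  then show "coord x a 1 - coord x b 1 \<noteq> coord x a 2 - coord x b 2"
    using nz \<open>a \<noteq> b\<close> exhaust_3[of a] exhaust_3[of b] by (auto simp: coord_def)
qed (use assms in \<open>simp add: genericity_def\<close>)

lemma ex_genericity_nonzero: "\<exists>x :: 'k::field_char_0 ^ (2 \<times> 2). x \<noteq> 0 \<and> genericity x \<noteq> 0"
proof (intro exI conjI)
  \<comment> \<open>The rows (1, 2) and (3, 5) make the form equal to -360, nonzero in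
    characteristic zero.\<close>
  let ?x = "\<chi> z. (if z = (1, 1) then 1 else if z = (1, 2) then 2 else if z = (2, 1) then 3 else 5 :: 'k) :: 'k ^ (2 \<times> 2)"
  show "genericity ?x \<noteq> 0" by (simp add: genericity_def)
  show "?x \<noteq> 0"
  proof
    assume "?x = 0"
    from arg_cong[OF this, of "\<lambda>v. v $ (1, 1)"] show False by simp
  qed
qed

theorem theorem1:
  shows "\<exists>U :: ('k :: {alg_closed_field, field_char_0} ^ (2 \<times> 2)) set set.
    zariski_open U \<and> U \<noteq> {} \<and>
    (\<forall>x. x \<noteq> 0 \<and> proj_point x \<in> U \<longrightarrow>
       vectorspace.fin_dim class_ring (S_algebra x) \<and>
       vectorspace.dim class_ring (S_algebra x) = 18 \<and>
       algebra_iso (S_algebra x)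
         (algebra_direct_sum (power_algebra :: ('k, 'k ^ 9) module)
                             (matrix_algebra :: ('k, 'k ^ 3 ^ 3) module)) \<noteq> {})"
proof (intro exI conjI allI impI)
  let ?U = "{proj_point x |x :: 'k ^ (2 \<times> 2). x \<noteq> 0 \<and> genericity x \<noteq> 0}"
  show "zariski_open ?U"
    by (rule zariski_open_nonvanishing_set[OF is_form_genericity])
  show "?U \<noteq> {}"
    using ex_genericity_nonzero by blast
  fix x :: "'k ^ (2 \<times> 2)"
  assume "x \<noteq> 0 \<and> proj_point x \<in> ?U"
  \<comment> \<open>Membership in \<open>?U\<close> provides only some representative; homogeneity
    carries nonvanishing over to the given \<open>x\<close>.\<close>
  then have "genericity x \<noteq> 0"
    by (intro proj_point_in_nonvanishing_set[OF is_form_genericity]) (rule conjunct2)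
  then interpret generic_point x by (rule generic_point_if_genericity)
  show "vectorspace.fin_dim class_ring (S_algebra x)" "vectorspace.dim class_ring (S_algebra x) = 18"
    by (rule S_algebra_dim)+
  show "algebra_iso (S_algebra x) target \<noteq> {}"
    using S_algebra_iso by blast
qed
end
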